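(* (a) Let $V$ be a $\mathcal{W}_\infty^+$-module which, by restriction, is a free $U(\mathfrak{h}_\infty)$-module of rank $1$. Then $V\cong\Omega(\Lambda_\infty,a,S)$ as $\mathcal{W}_\infty^+$-modules for some $\Lambda_\infty\in(\mathbb{C}^* )^\infty$, some $a\in\mathbb{C}$ and some subset $S$ of $\mathbb{N}$. (b) Let $M$ be a $\mathcal{W}_\infty$-module which, by restriction, is a free $U(\mathfrak{h}_\infty)$-module of rank $1$. Then $M\cong\Omega(\Lambda_\infty,a)$ as $\mathcal{W}_\infty$-modules for some $\Lambda_\infty\in(\mathbb{C}^* )^\infty$ and some $a\in\mathbb{C}$.
   Context: $\mathbb{N}$ is the set of positive integers, $\mathbb{Z}_+$ the set of non-negative integers, $\mathbb{C}^*=\mathbb{C}\setminus\{0\}$, and $(\mathbb{C}^* )^\infty$ is the set of all sequences $(\lambda_i)_{i\in\mathbb{N}}$ with $\lambda_i\in\mathbb{C}^*$. $\mathbb{Z}^\infty$ is the set of integer sequences $k=(k_1,k_2,\dots)$ with only finitely many nonzero entries, and for $i\in\mathbb{N}$ $$\mathbb{Z}^\infty_{+,i}=\{k\in\mathbb{Z}^\infty: k_i\ge -1,\ k_j\in\mathbb{Z}_+\text{ for all }j\ne i\}.$$ Let $\mathcal{A}_\infty=\mathbb{C}[t_1^{\pm1},t_2^{\pm1},\dots]$ (countably many variables), $\partial_i=t_i\frac{\partial}{\partial t_i}$, and $t^k=\prod_i t_i^{k_i}$. The Lie algebra $\mathcal{W}_\infty=\bigoplus_{i\in\mathbb{N}}\mathcal{A}_\infty\partial_i$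 has basis $\{t^k\partial_i: i\in\mathbb{N},\ k\in\mathbb{Z}^\infty\}$ and bracket $[t^r\partial_i,t^s\partial_j]=s_it^{r+s}\partial_j-r_jt^{r+s}\partial_i$. The Lie subalgebra $\mathcal{W}_\infty^+=\bigoplus_{i\in\mathbb{N}}\mathbb{C}[t_1,t_2,\dots]\frac{\partial}{\partial t_i}$ has basis $\{t^k\partial_i: i\in\mathbb{N},\ k\in\mathbb{Z}^\infty_{+,i}\}$. Both have Cartan subalgebra $\mathfrak{h}_\infty=\bigoplus_{i=1}^\infty\mathbb{C}\partial_i$, so $U(\mathfrak{h}_\infty)=\mathbb{C}[\partial_1,\partial_2,\dots]$. For $\Lambda_\infty=(\lambda_i)_{i\in\mathbb{N}}\in(\mathbb{C}^* )^\infty$ and $k\in\mathbb{Z}^\infty$ put $\Lambda_\infty^k=\prod_i\lambda_i^{k_i}$ (a finite product). Definition of $\Omega(\Lambda_\infty,a)$, for $a\in\mathbb{C}$: the $\mathcal{W}_\infty$-module with underlying space $\mathbb{C}[x_1,x_2,\dots]$ and action $$t^k\partial_i\cdot f(x_1,x_2,\dots)=\Lambda_\infty^k\,(x_i-k_i(a+1))\,f(x_1-k_1,x_2-k_2,\dots),\qquad k\in\mathbb{Z}^\infty,\ i\in\mathbb{N}.$$ Definition of $\Omega(\Lambda_\infty,a,S)$, for $a\in\mathbb{C}$, $S\subset\mathbb{N}$: for $i\in\mathbb{N}$ and $k\in\mathbb{Z}^\infty_{+,i}$ put $$\phi_{S,a}(k,i)=(x_i-k_i(a+1))\prod_{q\in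 S}\prod_{p=0}^{k_q-1}(x_q+a-p)\quad\text{if }k_i\ne -1\text{ or }i\notin S,$$ $$\phi_{S,a}(k,i)=\prod_{q\in S\setminus\{i\}}\prod_{p=0}^{k_q-1}(x_q+a-p)\quad\text{if }k_i=-1\text{ and }i\in S,$$ with the convention $\prod_{p=0}^{-1}g(p)=1$ (so only finitely many factors differ from $1$). Then $\Omega(\Lambda_\infty,a,S)$ is the $\mathcal{W}_\infty^+$-module with underlying space $\mathbb{C}[x_1,x_2,\dots]$ and action $$t^k\partial_i\cdot f(x_1,x_2,\dots)=\Lambda_\infty^k\,f(x_1-k_1,x_2-k_2,\dots)\,\phi_{S,a}(k,i),\qquad i\in\mathbb{N},\ k\in\mathbb{Z}^\infty_{+,i}.$$ *)

theory Defs
  imports Complex_Main "HOL-Library.Poly_Mapping"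
begin

text \<open>The positive integers that index the variables are represented by \<^typ>\<open>nat\<close>,
  the index \<open>i\<close> standing for the variable number \<open>i + 1\<close>; nothing below depends on the labels.\<close>

type_synonym int_seq = "nat \<Rightarrow>\<^sub>0 int"

text \<open>An element of \<open>W\<^sub>\<infinity>\<close> is given by its coefficients with respect to the basis
  \<open>t\<^sup>k \<partial>\<^sub>i\<close>, indexed by the pairs \<open>(k, i)\<close>.\<close>

type_synonym witt = "(int_seq \<times> nat) \<Rightarrow>\<^sub>0 complex"

definition witt_basis :: "int_seq \<Rightarrow> nat \<Rightarrow> witt" where
  "witt_basis k i = Poly_Mapping.single (k, i) 1"

definition witt_scale :: "complex \<Rightarrow> witt \<Rightarrow> witt" where
  "witt_scale c x = Poly_Mapping.map (\<lambda>b. c * b) x"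

text \<open>The bilinear extension of
  \<open>[t\<^sup>r \<partial>\<^sub>i, t\<^sup>s \<partial>\<^sub>j] = s\<^sub>i t\<^sup>r\<^sup>+\<^sup>s \<partial>\<^sub>j - r\<^sub>j t\<^sup>r\<^sup>+\<^sup>s \<partial>\<^sub>i\<close>.\<close>

definition witt_bracket :: "witt \<Rightarrow> witt \<Rightarrow> witt" where
  "witt_bracket x y =
     (\<Sum>(r, i)\<in>Poly_Mapping.keys x. \<Sum>(s, j)\<in>Poly_Mapping.keys y.
        witt_scale (Poly_Mapping.lookup x (r, i) * Poly_Mapping.lookup y (s, j))
          (witt_scale (of_int (Poly_Mapping.lookup s i)) (witt_basis (r + s) j)
           - witt_scale (of_int (Poly_Mapping.lookup r j)) (witt_basis (r + s) i)))"

definition int_seq_plus :: "nat \<Rightarrow> int_seq set" where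
  "int_seq_plus i =
     {k. Poly_Mapping.lookup k i \<ge> -1 \<and> (\<forall>j. j \<noteq> i \<longrightarrow> Poly_Mapping.lookup k j \<ge> 0)}"

definition witt_plus :: "witt set" where
  "witt_plus = {x. \<forall>(k, i)\<in>Poly_Mapping.keys x. k \<in> int_seq_plus i}"

text \<open>Modules over a Lie subalgebra \<open>L\<close> of \<open>W\<^sub>\<infinity>\<close>. The action is a total function, but its values
  outside \<open>L\<close> are never used.\<close>

locale witt_module = vector_space scale
  for L :: "witt set"
  and scale :: "complex \<Rightarrow> 'v \<Rightarrow> 'v::ab_group_add"
  and act :: "witt \<Rightarrow> 'v \<Rightarrow> 'v" +
  assumes act_linear: "x \<in> L \<Longrightarrow> Vector_Spaces.linear scale scale (act x)"
    and act_add: "x \<in> L \<Longrightarrow> y \<in> L \<Longrightarrow> act (x + y) v = act x v + act y v"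
    and act_scale: "x \<in> L \<Longrightarrow> act (witt_scale c x) v = scale c (act x v)"
    and act_bracket: "x \<in> L \<Longrightarrow> y \<in> L \<Longrightarrow>
      act (witt_bracket x y) v = act x (act y v) - act y (act x v)"

definition witt_module_iso ::
  "witt set \<Rightarrow> (complex \<Rightarrow> 'v \<Rightarrow> 'v::ab_group_add) \<Rightarrow> (witt \<Rightarrow> 'v \<Rightarrow> 'v)
    \<Rightarrow> (complex \<Rightarrow> 'w \<Rightarrow> 'w::ab_group_add) \<Rightarrow> (witt \<Rightarrow> 'w \<Rightarrow> 'w) \<Rightarrow> bool" where
  "witt_module_iso L scale act scale' act' \<longleftrightarrow>
     (\<exists>T. Vector_Spaces.linear scale scale' T \<and> bij T \<and>
        (\<forall>x\<in>L. \<forall>v. T (act x v) = act' x (T v)))"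

text \<open>Polynomials over the complex numbers in countably many variables: monomials are finitely
  supported exponent sequences, and multiplication is the convolution product.\<close>

type_synonym cpoly = "(nat \<Rightarrow>\<^sub>0 nat) \<Rightarrow>\<^sub>0 complex"

definition pvar :: "nat \<Rightarrow> cpoly" where
  "pvar i = Poly_Mapping.single (Poly_Mapping.single i 1) 1"

definition pconst :: "complex \<Rightarrow> cpoly" where
  "pconst c = Poly_Mapping.single 0 c"

definition pscale :: "complex \<Rightarrow> cpoly \<Rightarrow> cpoly" where
  "pscale c p = pconst c * p"

definition psubst :: "(nat \<Rightarrow> cpoly) \<Rightarrow> cpoly \<Rightarrow> cpoly" where
  "psubst \<sigma> p =
     (\<Sum>m\<in>Poly_Mapping.keys p. pconst (Poly_Mapping.lookup p m) *
        (\<Prod>i\<in>Poly_Mapping.keys m. \<sigma> i ^ Poly_Mapping.lookup m i))"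

definition pshift :: "int_seq \<Rightarrow> cpoly \<Rightarrow> cpoly" where
  "pshift k = psubst (\<lambda>i. pvar i - of_int (Poly_Mapping.lookup k i))"

text \<open>Since the Lie algebra \<open>h\<^sub>\<infinity>\<close> is abelian, its enveloping algebra is the polynomial algebra
  in the \<open>\<partial>\<^sub>i\<close>, so that \<^typ>\<open>cpoly\<close> serves as \<open>U(h\<^sub>\<infinity>)\<close>, with \<open>pvar i\<close> in the role
  of \<open>\<partial>\<^sub>i = t\<^sup>0 \<partial>\<^sub>i\<close>. The order of composition in a monomial is fixed
  only to have a definition; the operators \<open>\<partial>\<^sub>i\<close> commute on every module.\<close>

definition cartan_monom_act :: "(witt \<Rightarrow> 'v \<Rightarrow> 'v) \<Rightarrow> (nat \<Rightarrow>\<^sub>0 nat) \<Rightarrow> 'v \<Rightarrow> 'v" where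
  "cartan_monom_act act m v =
     foldr (\<lambda>i. act (witt_basis 0 i) ^^ Poly_Mapping.lookup m i)
       (sorted_list_of_set (Poly_Mapping.keys m)) v"

definition cartan_act ::
  "(complex \<Rightarrow> 'v \<Rightarrow> 'v::ab_group_add) \<Rightarrow> (witt \<Rightarrow> 'v \<Rightarrow> 'v) \<Rightarrow> cpoly \<Rightarrow> 'v \<Rightarrow> 'v" where
  "cartan_act scale act p v =
     (\<Sum>m\<in>Poly_Mapping.keys p. scale (Poly_Mapping.lookup p m) (cartan_monom_act act m v))"

text \<open>Free of rank 1 over \<open>U(h\<^sub>\<infinity>)\<close>: some one-element set \<open>{v}\<close> is a basis.\<close>

definition cartan_free_rank_one ::
  "(complex \<Rightarrow> 'v \<Rightarrow> 'v::ab_group_add) \<Rightarrow> (witt \<Rightarrow> 'v \<Rightarrow> 'v) \<Rightarrow> bool" where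
  "cartan_free_rank_one scale act \<longleftrightarrow> (\<exists>v. \<forall>u. \<exists>!p. cartan_act scale act p v = u)"

definition seq_power :: "(nat \<Rightarrow> complex) \<Rightarrow> int_seq \<Rightarrow> complex" where
  "seq_power \<Lambda> k = (\<Prod>i\<in>Poly_Mapping.keys k. \<Lambda> i powi Poly_Mapping.lookup k i)"

definition linear_extension :: "(int_seq \<Rightarrow> nat \<Rightarrow> cpoly \<Rightarrow> cpoly) \<Rightarrow> witt \<Rightarrow> cpoly \<Rightarrow> cpoly" where
  "linear_extension B x f =
     (\<Sum>(k, i)\<in>Poly_Mapping.keys x. pscale (Poly_Mapping.lookup x (k, i)) (B k i f))"

definition Omega_act :: "(nat \<Rightarrow> complex) \<Rightarrow> complex \<Rightarrow> witt \<Rightarrow> cpoly \<Rightarrow> cpoly" where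
  "Omega_act \<Lambda> a = linear_extension (\<lambda>k i f.
     pscale (seq_power \<Lambda> k)
       ((pvar i - pconst (of_int (Poly_Mapping.lookup k i) * (a + 1))) * pshift k f))"

text \<open>The factor of \<open>\<phi>\<^bsub>S,a\<^esub>\<close> belonging to \<open>q\<close> is 1 unless \<open>k\<^sub>q > 0\<close>, so the product over a
  possibly infinite set of indices is restricted to the support of \<open>k\<close>.\<close>

definition phi_prod :: "nat set \<Rightarrow> complex \<Rightarrow> int_seq \<Rightarrow> cpoly" where
  "phi_prod S a k = (\<Prod>q\<in>S \<inter> Poly_Mapping.keys k.
     \<Prod>p<nat (Poly_Mapping.lookup k q). (pvar q + pconst a - of_nat p))"

definition phi :: "nat set \<Rightarrow> complex \<Rightarrow> int_seq \<Rightarrow> nat \<Rightarrow> cpoly" where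
  "phi S a k i =
     (if Poly_Mapping.lookup k i = -1 \<and> i \<in> S then phi_prod (S - {i}) a k
      else (pvar i - pconst (of_int (Poly_Mapping.lookup k i) * (a + 1))) * phi_prod S a k)"

definition Omega_plus_act :: "(nat \<Rightarrow> complex) \<Rightarrow> complex \<Rightarrow> nat set \<Rightarrow> witt \<Rightarrow> cpoly \<Rightarrow> cpoly" where
  "Omega_plus_act \<Lambda> a S = linear_extension (\<lambda>k i f.
     pscale (seq_power \<Lambda> k) (pshift k f * phi S a k i))"

end

theory Submission
  imports Defs "HOL-Computational_Algebra.Polynomial"
begin

text \<open>On a free module of rank one, identified with the polynomial ring by a free generator,
  \<open>\<partial>\<^sub>i\<close> is multiplication by \<open>x\<^sub>i\<close>. The relation \<open>[\<partial>\<^sub>j, t\<^sup>k \<partial>\<^sub>i] = k\<^sub>j t\<^sup>k \<partial>\<^sub>i\<close> then forces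
  \<open>t\<^sup>k \<partial>\<^sub>i\<close> to act as \<open>f \<mapsto> \<sigma>\<^sup>k(f) \<phi>(k, i)\<close>, where \<open>\<sigma>\<^sup>k\<close> is the shift \<open>x \<mapsto> x - k\<close> and
  \<open>\<phi>(k, i)\<close> is the image of 1. So a module structure is a family of polynomials that satisfies the
  cocycle identity
  \<open>\<phi>(r,i) \<sigma>\<^sup>r\<phi>(s,j) - \<phi>(s,j) \<sigma>\<^sup>s\<phi>(r,i) = s\<^sub>i \<phi>(r+s,j) - r\<^sub>j \<phi>(r+s,i)\<close>,
  and the theorem says what these families are.

  Write \<open>\<epsilon> i\<close> for the \<open>i\<close>-th unit sequence and \<open>\<sigma>\<^sub>i\<close> for the shift by it. The polynomials that decide everything are those of
  the lowering operators \<open>D\<^sub>i = t\<^sub>i\<^sup>-\<^sup>1 \<partial>\<^sub>i\<close>, namely \<open>\<phi>(-\<epsilon> i, i)\<close>, and of the raising operators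
  \<open>t\<^sub>i \<partial>\<^sub>j\<close> with \<open>j \<noteq> i\<close>. There are at least three variables, and any two of the raising operators
  \<open>t\<^sub>i \<partial>\<^sub>j\<close>, \<open>t\<^sub>i \<partial>\<^sub>l\<close> commute. Together with \<open>[D\<^sub>i, t\<^sub>i \<partial>\<^sub>j] = \<partial>\<^sub>j\<close> this gives
  \<open>\<phi>(\<epsilon> i, j) = x\<^sub>j \<theta>\<^sub>i\<close> with one polynomial \<open>\<theta>\<^sub>i\<close> for all \<open>j\<close> (\<open>raise_factor_exists\<close>). The product
  \<open>\<phi>(-\<epsilon> i, i) \<sigma>\<^sub>i\<^sup>-\<^sup>1\<theta>\<^sub>i\<close> minus \<open>x\<^sub>i\<close> turns out to be invariant under all shifts, hence constant
  (\<open>lower_raise_factor_linear\<close>). A linear polynomial \<open>x\<^sub>i + \<alpha>\<close> is irreducible, so one of the two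
  factors is a constant: it is the lowering one exactly for \<open>i\<close> in a set \<open>S\<close>. The relation
  \<open>[t\<^sub>iD\<^sub>l, t\<^sub>lD\<^sub>i] = \<partial>\<^sub>i - \<partial>\<^sub>l\<close> makes the constants \<open>\<alpha>\<close> of all indices equal, and \<open>a = \<alpha> - 1\<close>
  (\<open>lower_raise_normal_form\<close>).

  The remaining values follow from these by brackets through a fresh index \<open>l\<close>, one at which the
  exponents involved vanish. Such an index always exists because there are infinitely many variables.
  The bracket of \<open>t\<^sup>k D\<^sub>l\<close> and \<open>t\<^sup>s t\<^sub>l \<partial>\<^sub>j\<close> extends the formula from \<open>k\<close> and \<open>s\<close> to \<open>k + s\<close>
  (\<open>settled_add\<close>) as long as \<open>k\<^sub>j = 0\<close>, and the bracket of \<open>t\<^sup>k D\<^sub>l\<close> and \<open>t\<^sub>l \<partial>\<^sub>j\<close> gives all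
  \<open>\<phi>(k, j)\<close> (\<open>settled_formula\<close>). Over the whole algebra \<open>W\<^sub>\<infinity>\<close>, the commutator
  \<open>[t\<^sub>i \<partial>\<^sub>i, t\<^sub>i\<^sup>-\<^sup>1 \<partial>\<^sub>l] = - \<partial>\<^sub>l\<close> makes a shift of \<open>\<theta>\<^sub>i\<close> a divisor of \<open>x\<^sub>l\<close>, so that
  \<open>S\<close> is empty (\<open>full_imp_S_empty\<close>); the same argument then covers negative exponents.\<close>

section \<open>Substitution homomorphisms\<close>

abbreviation \<epsilon> :: "nat \<Rightarrow> int_seq" where "\<epsilon> i \<equiv> Poly_Mapping.single i 1"

lemma poly_mapping_induct_add [case_names zero single add]:
  fixes p :: "'a \<Rightarrow>\<^sub>0 'b::comm_monoid_add"
  assumes "P 0" "\<And>m c. P (Poly_Mapping.single m c)" "\<And>p q. P p \<Longrightarrow> P q \<Longrightarrow> P (p + q)"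
  shows "P p"
proof (induction p rule: Poly_Mapping.update_induct)
  case const
  then show ?case using assms(1) by simp
next
  case (update f a b)
  have "Poly_Mapping.update a b f = f + Poly_Mapping.single a b"
    using update(1)
    by (intro poly_mapping_eqI)
       (auto simp: lookup_update lookup_add lookup_single when_def in_keys_iff)
  then show ?case using assms update by simp
qed

text \<open>Substitutions are needed with values in the polynomial ring itself and in univariate
  polynomials over it; a homomorphism on the coefficients is all that they have in common.\<close>

locale coeff_hom =
  fixes C :: "complex \<Rightarrow> 'b::comm_ring_1"
  assumes C_0: "C 0 = 0" and C_1: "C 1 = 1"
    and C_add: "C (a + b) = C a + C b" and C_mult: "C (a * b) = C a * C b"
begin

definition subst_monom :: "(nat \<Rightarrow> 'b) \<Rightarrow> (nat \<Rightarrow>\<^sub>0 nat) \<Rightarrow> 'b" where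
  "subst_monom \<sigma> m = (\<Prod>i\<in>Poly_Mapping.keys m. \<sigma> i ^ Poly_Mapping.lookup m i)"

definition subst :: "(nat \<Rightarrow> 'b) \<Rightarrow> cpoly \<Rightarrow> 'b" where
  "subst \<sigma> p = (\<Sum>m\<in>Poly_Mapping.keys p. C (Poly_Mapping.lookup p m) * subst_monom \<sigma> m)"

lemma subst_monom_superset:
  "finite A \<Longrightarrow> Poly_Mapping.keys m \<subseteq> A \<Longrightarrow>
    subst_monom \<sigma> m = (\<Prod>i\<in>A. \<sigma> i ^ Poly_Mapping.lookup m i)"
  unfolding subst_monom_def
  by (rule prod.mono_neutral_left) (auto simp: in_keys_iff)

lemma subst_monom_add: "subst_monom \<sigma> (m + n) = subst_monom \<sigma> m * subst_monom \<sigma> n"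
  by (simp add: subst_monom_superset[of "Poly_Mapping.keys m \<union> Poly_Mapping.keys n"] keys_add
      lookup_add power_add prod.distrib)

lemma subst_superset:
  "finite A \<Longrightarrow> Poly_Mapping.keys p \<subseteq> A \<Longrightarrow>
    subst \<sigma> p = (\<Sum>m\<in>A. C (Poly_Mapping.lookup p m) * subst_monom \<sigma> m)"
  unfolding subst_def by (rule sum.mono_neutral_left) (auto simp: in_keys_iff C_0)

lemma subst_add: "subst \<sigma> (p + q) = subst \<sigma> p + subst \<sigma> q"
  by (simp add: subst_superset[of "Poly_Mapping.keys p \<union> Poly_Mapping.keys q"] keys_add
      lookup_add C_add distrib_right sum.distrib)

lemma subst_0: "subst \<sigma> 0 = 0"
  by (simp add: subst_def)

lemma subst_single: "subst \<sigma> (Poly_Mapping.single m c) = C c * subst_monom \<sigma> m"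
  by (simp add: subst_def C_0)

lemma subst_mult: "subst \<sigma> (p * q) = subst \<sigma> p * subst \<sigma> q"
proof (induction p rule: poly_mapping_induct_add)
  case (single m c)
  show ?case
    by (induction q rule: poly_mapping_induct_add)
       (simp_all add: subst_0 subst_single mult_single subst_add subst_monom_add C_mult distrib_left)
qed (simp_all add: subst_0 subst_add distrib_right)

lemma subst_pconst: "subst \<sigma> (pconst c) = C c"
  by (simp add: pconst_def subst_single subst_monom_def)

lemma subst_pvar: "subst \<sigma> (pvar i) = \<sigma> i"
  by (simp add: pvar_def subst_single subst_monom_def C_1)

end

lemma pconst_simps:
  "pconst 0 = 0" "pconst 1 = 1" "pconst (a + b) = pconst a + pconst b"
  "pconst (a * b) = pconst a * pconst b" "pconst (- a) = - pconst a"
  "pconst (a - b) = pconst a - pconst b" "pconst (of_int n) = of_int n" "pconst (of_nat l) = of_nat l"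
  by (simp_all add: pconst_def single_add mult_single single_uminus single_diff)

lemma pconst_eq_iff [simp]: "pconst a = pconst b \<longleftrightarrow> a = b"
  by (metis pconst_def lookup_single_eq)

lemma pconst_eq_0_iff [simp]: "pconst a = 0 \<longleftrightarrow> a = 0"
  by (metis pconst_eq_iff pconst_simps(1))

interpretation pconst: coeff_hom pconst
  by unfold_locales (simp_all add: pconst_simps)

interpretation pconst_poly: coeff_hom "\<lambda>c. [:pconst c:]"
  by unfold_locales (simp_all add: pconst_simps one_pCons)

lemma psubst_eq: "psubst = pconst.subst"
  by (intro ext) (simp add: psubst_def pconst.subst_def pconst.subst_monom_def)

text \<open>An identity between ring homomorphisms on the polynomial ring only has to be checked on
  constants and variables.\<close>

lemma cpoly_induct [case_names const var add mult]:
  assumes c: "\<And>c. P (pconst c)" and v: "\<And>i. P (pvar i)"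
    and a: "\<And>p q. P p \<Longrightarrow> P q \<Longrightarrow> P (p + q)" and m: "\<And>p q. P p \<Longrightarrow> P q \<Longrightarrow> P (p * q)"
  shows "P p"
proof (induction p rule: poly_mapping_induct_add)
  case zero
  then show ?case using c[of 0] by (simp add: pconst_simps)
next
  case (single n d)
  have "P (Poly_Mapping.single n 1)"
  proof (induction n rule: poly_mapping_induct_add)
    case zero
    then show ?case using c[of 1] by (simp add: pconst_def)
  next
    case (single i k)
    show ?case
    proof (induction k)
      case 0
      then show ?case using c[of 1] by (simp add: pconst_def)
    next
      case (Suc k)
      have "Poly_Mapping.single (Poly_Mapping.single i (Suc k)) 1
          = pvar i * Poly_Mapping.single (Poly_Mapping.single i k) (1::complex)"
        by (simp add: pvar_def mult_single flip: single_add)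
      then show ?case using m[OF v Suc] by simp
    qed
  next
    case (add p q)
    then show ?case using m[OF add] by (simp add: mult_single)
  qed
  from m[OF c[of d] this] show ?case by (simp add: pconst_def mult_single)
qed (rule a)

lemma psubst_simps [simp]:
  "psubst \<sigma> (pconst c) = pconst c" "psubst \<sigma> (pvar i) = \<sigma> i"
  "psubst \<sigma> (p + q) = psubst \<sigma> p + psubst \<sigma> q" "psubst \<sigma> (p * q) = psubst \<sigma> p * psubst \<sigma> q"
  by (simp_all add: psubst_eq pconst.subst_pconst pconst.subst_pvar pconst.subst_add pconst.subst_mult)

lemma psubst_ring_simps [simp]:
  "psubst \<sigma> 0 = 0" "psubst \<sigma> 1 = 1" "psubst \<sigma> (- p) = - psubst \<sigma> p"
  "psubst \<sigma> (p - q) = psubst \<sigma> p - psubst \<sigma> q"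
  "psubst \<sigma> (of_int n) = of_int n" "psubst \<sigma> (of_nat l) = of_nat l"
proof -
  show 0: "psubst \<sigma> 0 = 0" using psubst_simps(1)[of \<sigma> 0] by (simp add: pconst_simps)
  show "psubst \<sigma> 1 = 1" using psubst_simps(1)[of \<sigma> 1] by (simp add: pconst_simps)
  have m: "psubst \<sigma> (- p) = - psubst \<sigma> p" for p
    using psubst_simps(3)[of \<sigma> p "-p"] by (simp add: 0 eq_neg_iff_add_eq_0 add.commute)
  then show "psubst \<sigma> (- p) = - psubst \<sigma> p" .
  show "psubst \<sigma> (p - q) = psubst \<sigma> p - psubst \<sigma> q"
    using psubst_simps(3)[of \<sigma> p "-q"] m[of q] by simp
  show "psubst \<sigma> (of_int n) = of_int n" using psubst_simps(1)[of \<sigma> "of_int n"] by (simp add: pconst_simps)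
  show "psubst \<sigma> (of_nat l) = of_nat l" using psubst_simps(1)[of \<sigma> "of_nat l"] by (simp add: pconst_simps)
qed

lemma psubst_prod: "psubst \<sigma> (prod f A) = (\<Prod>i\<in>A. psubst \<sigma> (f i))"
  by (induction A rule: infinite_finite_induct) simp_all

lemma psubst_psubst: "psubst \<sigma> (psubst \<tau> p) = psubst (\<lambda>i. psubst \<sigma> (\<tau> i)) p"
  by (induction p rule: cpoly_induct) simp_all

lemma psubst_pvar_id: "psubst pvar p = p"
  by (induction p rule: cpoly_induct) simp_all

lemma pshift_simps [simp]:
  "pshift k (pconst c) = pconst c" "pshift k (pvar i) = pvar i - of_int (Poly_Mapping.lookup k i)"
  "pshift k (p + q) = pshift k p + pshift k q" "pshift k (p * q) = pshift k p * pshift k q"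
  "pshift k 0 = 0" "pshift k 1 = 1" "pshift k (- p) = - pshift k p"
  "pshift k (p - q) = pshift k p - pshift k q"
  "pshift k (of_int n) = of_int n" "pshift k (of_nat l) = of_nat l"
  by (simp_all add: pshift_def)

lemma pshift_prod: "pshift k (prod f A) = (\<Prod>i\<in>A. pshift k (f i))"
  by (simp add: pshift_def psubst_prod)

lemma pshift_pshift [simp]: "pshift k (pshift r p) = pshift (k + r) p"
  by (induction p rule: cpoly_induct) (simp_all add: lookup_add)

lemma pshift_zero [simp]: "pshift 0 p = p"
  by (induction p rule: cpoly_induct) simp_all

lemma pshift_cancel_iff [simp]: "pshift k p = pshift k q \<longleftrightarrow> p = q"
  by (metis pshift_pshift pshift_zero ab_left_minus)

lemma pshift_eq_0_iff [simp]: "pshift k p = 0 \<longleftrightarrow> p = 0"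
  using pshift_cancel_iff[of k p 0] by (simp del: pshift_cancel_iff)

lemma pshift_invariant_uminus: "pshift (-k) p = p \<longleftrightarrow> pshift k p = p"
  by (metis pshift_pshift pshift_zero ab_left_minus)

lemma pvar_neq_pconst [simp]: "pvar i \<noteq> pconst c"
proof
  assume "pvar i = pconst c"
  from arg_cong[OF this, of "psubst (\<lambda>_. pconst (c + 1))"] show False by simp
qed

lemma pvar_neq_0 [simp]: "pvar i \<noteq> 0"
  using pvar_neq_pconst[of i 0] by (simp add: pconst_simps)

section \<open>Constants, variables and linear polynomials\<close>

definition set_zero :: "nat set \<Rightarrow> cpoly \<Rightarrow> cpoly" where
  "set_zero A = psubst (\<lambda>j. if j \<in> A then 0 else pvar j)"

lemma set_zero_insert: "set_zero (insert i A) p = set_zero A (set_zero {i} p)"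
  unfolding set_zero_def psubst_psubst by (rule arg_cong[where f = "\<lambda>\<sigma>. psubst \<sigma> p"]) auto

text \<open>A polynomial involves finitely many variables. Quantifying over all larger sets lets the
  two sets of a sum or a product be merged.\<close>

lemma set_zero_finite_const: "\<exists>A. finite A \<and> (\<forall>B. A \<subseteq> B \<longrightarrow> set_zero B p \<in> range pconst)"
proof (induction p rule: cpoly_induct)
  case (const c)
  then show ?case by (auto simp: set_zero_def)
next
  case (var i)
  have "set_zero B (pvar i) = pconst 0" if "{i} \<subseteq> B" for B
    using that by (simp add: set_zero_def pconst_simps)
  then show ?case by (intro exI[of _ "{i}"]) auto
next
  case (add p q)
  then obtain A A' where A: "finite A" "\<forall>B. A \<subseteq> B \<longrightarrow> set_zero B p \<in> range pconst"
    "finite A'" "\<forall>B. A' \<subseteq> B \<longrightarrow> set_zero B q \<in> range pconst" by blast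
  have "set_zero B (p + q) \<in> range pconst" if B: "A \<union> A' \<subseteq> B" for B
  proof -
    from A B obtain x y where "set_zero B p = pconst x" "set_zero B q = pconst y" by (metis Un_subset_iff imageE)
    then have "set_zero B (p + q) = pconst (x + y)" by (simp add: set_zero_def pconst_simps)
    then show ?thesis by simp
  qed
  then show ?case using A by (intro exI[of _ "A \<union> A'"]) auto
next
  case (mult p q)
  then obtain A A' where A: "finite A" "\<forall>B. A \<subseteq> B \<longrightarrow> set_zero B p \<in> range pconst"
    "finite A'" "\<forall>B. A' \<subseteq> B \<longrightarrow> set_zero B q \<in> range pconst" by blast
  have "set_zero B (p * q) \<in> range pconst" if B: "A \<union> A' \<subseteq> B" for B
  proof -
    from A B obtain x y where "set_zero B p = pconst x" "set_zero B q = pconst y" by (metis Un_subset_iff imageE)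
    then have "set_zero B (p * q) = pconst (x * y)" by (simp add: set_zero_def pconst_simps)
    then show ?thesis by simp
  qed
  then show ?case using A by (intro exI[of _ "A \<union> A'"]) auto
qed

lemma set_zero_invariant_imp_const:
  assumes "\<And>i. set_zero {i} p = p"
  shows "p \<in> range pconst"
proof -
  obtain A where A: "finite A" "\<forall>B. A \<subseteq> B \<longrightarrow> set_zero B p \<in> range pconst"
    using set_zero_finite_const[of p] by (elim exE conjE)
  have "set_zero A p = p" using A(1)
  proof (induction A rule: finite_induct)
    case empty
    then show ?case by (simp add: set_zero_def psubst_pvar_id)
  next
    case (insert i A)
    then show ?case by (subst set_zero_insert) (simp only: assms)
  qed
  then show ?thesis using A(2)[rule_format, OF order_refl] by simp
qed

text \<open>Substitute \<open>x\<^sub>i + t\<close> for \<open>x\<^sub>i\<close>, with a new variable \<open>t\<close>. If the polynomial is periodic in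
  \<open>x\<^sub>i\<close>, the result takes the same value at all natural numbers \<open>t\<close>, so it does not depend on
  \<open>t\<close>, and \<open>t = - x\<^sub>i\<close> eliminates \<open>x\<^sub>i\<close>.\<close>

lemma pshift_invariant_imp_set_zero:
  assumes "pshift (\<epsilon> i) p = p"
  shows "set_zero {i} p = p"
proof -
  define H where "H q = pconst_poly.subst (\<lambda>j. if j = i then [:pvar j, 1:] else [:pvar j:]) q" for q
  have H: "poly (H q) t = psubst (\<lambda>j. if j = i then pvar j + t else pvar j) q" for q t
    by (induction q rule: cpoly_induct)
       (simp_all add: H_def pconst_poly.subst_pconst pconst_poly.subst_pvar pconst_poly.subst_add
         pconst_poly.subst_mult)
  have inv: "pshift (Poly_Mapping.single i (- int n)) p = p" for n
  proof (induction n)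
    case (Suc n)
    have "Poly_Mapping.single i (- int (Suc n)) = - \<epsilon> i + Poly_Mapping.single i (- int n)"
      by (simp flip: single_add single_uminus)
    then show ?case
      using Suc assms by (metis pshift_pshift pshift_invariant_uminus)
  qed simp
  have sh: "psubst (\<lambda>j. if j = i then pvar j + of_nat n else pvar j) p
      = pshift (Poly_Mapping.single i (- int n)) p" for n
    unfolding pshift_def
    by (rule arg_cong[where f = "\<lambda>\<sigma>. psubst \<sigma> p"]) (auto simp: lookup_single fun_eq_iff)
  have root: "poly (H p - [:p:]) (of_nat n) = 0" for n
    using H[of p "of_nat n"] sh[of n] inv[of n] by simp
  have "H p - [:p:] = 0"
  proof (rule ccontr)
    assume "H p - [:p:] \<noteq> 0"
    then have "finite {x. poly (H p - [:p:]) x = 0}" by (rule poly_roots_finite)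
    then have "finite (range (of_nat :: nat \<Rightarrow> cpoly))"
      by (rule rev_finite_subset) (use root in auto)
    then show False using finite_imageD[of of_nat UNIV] inj_of_nat infinite_UNIV_nat by blast
  qed
  then have "poly (H p) (- pvar i) = p" by simp
  moreover have "set_zero {i} p = poly (H p) (- pvar i)"
    unfolding H set_zero_def by (rule arg_cong[where f = "\<lambda>\<sigma>. psubst \<sigma> p"]) auto
  ultimately show ?thesis by simp
qed

lemma pshift_invariant_imp_const:
  assumes "\<And>i. pshift (\<epsilon> i) p = p"
  obtains c where "p = pconst c"
proof -
  have "set_zero {i} p = p" for i
    using pshift_invariant_imp_set_zero assms by blast
  then have "p \<in> range pconst" by (rule set_zero_invariant_imp_const)
  then show ?thesis using that by (elim imageE)
qed

lemma set_zero_simps [simp]: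
  "set_zero A (pconst c) = pconst c" "set_zero A (pvar i) = (if i \<in> A then 0 else pvar i)"
  "set_zero A (p + q) = set_zero A p + set_zero A q" "set_zero A (p * q) = set_zero A p * set_zero A q" "set_zero A 0 = 0"
  by (simp_all add: set_zero_def)

lemma pvar_dvd_minus_set_zero: "pvar i dvd p - set_zero {i} p"
proof (induction p rule: cpoly_induct)
  case (const c)
  show ?case by (simp only: set_zero_simps diff_self dvd_0_right)
next
  case (var j)
  show ?case by simp
next
  case (add p q)
  have "p + q - set_zero {i} (p + q) = (p - set_zero {i} p) + (q - set_zero {i} q)"
    by simp
  with add show ?case by (metis dvd_add)
next
  case (mult p q)
  have "p * q - set_zero {i} (p * q) = p * (q - set_zero {i} q) + set_zero {i} q * (p - set_zero {i} p)"
    by (simp add: algebra_simps)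
  with mult show ?case by (metis dvd_add dvd_mult)
qed

text \<open>Two different variables are coprime: set \<open>x\<^sub>j = 0\<close> in the hypothesis.\<close>

lemma pvar_prime_relation:
  assumes "pvar l * p = pvar j * q" "j \<noteq> l"
  obtains r where "p = pvar j * r" "q = pvar l * r"
proof -
  have "pvar l * set_zero {j} p = 0"
    using arg_cong[OF assms(1), of "set_zero {j}"] assms(2) by (simp add: set_zero_def)
  then have "set_zero {j} p = 0" by simp
  then obtain r where r: "p = pvar j * r" using pvar_dvd_minus_set_zero[of j p] by (auto elim: dvdE)
  then have "pvar j * q = pvar j * (pvar l * r)" using assms(1) by (simp add: algebra_simps)
  then show ?thesis using that r by simp
qed

text \<open>Irreducibility of a linear polynomial. Multiplying every variable by a new variable \<open>t\<close>
  turns the total degree into the degree in \<open>t\<close>, which is additive on products. Degree 0 in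
  \<open>t\<close> means constant, by comparison of \<open>t = 1\<close> with \<open>t = 0\<close>.\<close>

lemma linear_factor_const:
  assumes "f * g = pvar i + pconst c"
  shows "(\<exists>d. f = pconst d) \<or> (\<exists>d. g = pconst d)"
proof -
  define H where "H = pconst_poly.subst (\<lambda>j. [:0, pvar j:])"
  have H: "poly (H q) t = psubst (\<lambda>j. t * pvar j) q" for q t
    by (induction q rule: cpoly_induct)
       (simp_all add: H_def pconst_poly.subst_pconst pconst_poly.subst_pvar pconst_poly.subst_add
         pconst_poly.subst_mult)
  have const: "\<exists>d. q = pconst d" if deg: "degree (H q) = 0" for q
  proof -
    obtain b where "H q = [:b:]" using degree_eq_zeroE[OF deg] .
    then have "poly (H q) 1 = poly (H q) 0" by simp
    then have "q = psubst (\<lambda>j. 0) q" by (simp add: H psubst_pvar_id)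
    then have z: "psubst (\<lambda>j. 0) q = q" by (rule sym)
    have "set_zero {j} q = q" for j
    proof -
      have "set_zero {j} (psubst (\<lambda>j. 0) q) = psubst (\<lambda>j. 0) q"
        by (simp add: set_zero_def psubst_psubst)
      then show ?thesis unfolding z .
    qed
    then show ?thesis using set_zero_invariant_imp_const[of q] by blast
  qed
  have "H f * H g = [:pconst c, pvar i:]"
    unfolding H_def pconst_poly.subst_mult[symmetric] assms
    by (simp add: pconst_poly.subst_add pconst_poly.subst_pconst pconst_poly.subst_pvar)
  then have "H f * H g \<noteq> 0" "degree (H f * H g) = 1" by simp_all
  then have "degree (H f) + degree (H g) = 1" by (metis degree_mult_eq mult_eq_0_iff)
  then have "degree (H f) = 0 \<or> degree (H g) = 0" by auto
  then show ?thesis using const by blast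
qed

section \<open>The factors of the action on the model modules\<close>

lemma seq_power_superset:
  "finite A \<Longrightarrow> Poly_Mapping.keys k \<subseteq> A \<Longrightarrow> seq_power \<Lambda> k = (\<Prod>i\<in>A. \<Lambda> i powi Poly_Mapping.lookup k i)"
  unfolding seq_power_def by (rule prod.mono_neutral_left) (auto simp: in_keys_iff)

lemma seq_power_add:
  assumes "\<And>i. \<Lambda> i \<noteq> 0"
  shows "seq_power \<Lambda> (k + r) = seq_power \<Lambda> k * seq_power \<Lambda> r"
  using assms
  by (simp add: seq_power_superset[of "Poly_Mapping.keys k \<union> Poly_Mapping.keys r"] keys_add
      lookup_add power_int_add prod.distrib)

lemma seq_power_single: "seq_power \<Lambda> (Poly_Mapping.single i n) = \<Lambda> i powi n"
  by (simp add: seq_power_def)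

definition falling :: "complex \<Rightarrow> nat \<Rightarrow> int \<Rightarrow> cpoly" where
  "falling a q n = (\<Prod>p<nat n. pvar q + pconst a - of_nat p)"

lemma phi_prod_superset:
  "finite A \<Longrightarrow> Poly_Mapping.keys k \<subseteq> A \<Longrightarrow>
    phi_prod S a k = (\<Prod>q\<in>S \<inter> A. falling a q (Poly_Mapping.lookup k q))"
  unfolding phi_prod_def falling_def by (rule prod.mono_neutral_left) (auto simp: in_keys_iff)

lemma prod_lessThan_add:
  "prod f {..<m + n} = prod f {..<m::nat} * (\<Prod>p<n. f (m + p) :: 'a::comm_monoid_mult)"
  by (induction n) (simp_all add: ac_simps)

text \<open>Where \<open>k\<^sub>q = m\<close>, the shift by \<open>k\<close> replaces \<open>x\<^sub>q\<close> by \<open>x\<^sub>q - m\<close> and makes the second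
  falling product start where the first one stops.\<close>

lemma falling_add:
  assumes "0 \<le> m" "0 \<le> n" "Poly_Mapping.lookup k q = m"
  shows "falling a q (m + n) = falling a q m * pshift k (falling a q n)"
proof -
  have *: "nat (m + n) = nat m + nat n" using assms by (simp add: nat_add_distrib)
  have "pshift k (falling a q n) = (\<Prod>p<nat n. pvar q + pconst a - of_nat (nat m + p))"
    unfolding falling_def pshift_prod using assms
    by (intro prod.cong) (auto simp: algebra_simps simp flip: of_nat_add of_nat_nat)
  moreover have "falling a q (m + n) = falling a q m * (\<Prod>p<nat n. pvar q + pconst a - of_nat (nat m + p))"
    unfolding falling_def * by (rule prod_lessThan_add)
  ultimately show ?thesis by simp
qed

lemma phi_prod_add:
  assumes "\<And>i. 0 \<le> Poly_Mapping.lookup k i" "\<And>i. 0 \<le> Poly_Mapping.lookup r i"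
  shows "phi_prod S a (k + r) = phi_prod S a k * pshift k (phi_prod S a r)"
  using assms
  by (simp add: phi_prod_superset[of "Poly_Mapping.keys k \<union> Poly_Mapping.keys r"] keys_add
      lookup_add falling_add[where k = k] prod.distrib pshift_prod)

lemma phi_prod_pshift_disjoint:
  assumes "\<And>q. q \<in> Poly_Mapping.keys k \<Longrightarrow> Poly_Mapping.lookup r q = 0"
  shows "pshift r (phi_prod S a k) = phi_prod S a k"
  using assms unfolding phi_prod_def pshift_prod by (intro prod.cong) auto

lemma phi_prod_empty: "phi_prod {} a k = 1"
  by (simp add: phi_prod_def)

lemma phi_prod_single: "phi_prod S a (\<epsilon> i) = (if i \<in> S then pvar i + pconst a else 1)"
  by (simp add: phi_prod_def)

lemma phi_prod_0: "phi_prod S a 0 = 1"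
  by (simp add: phi_prod_def)

section \<open>Cocycles: lowering and raising operators\<close>

definition index_set :: "bool \<Rightarrow> nat \<Rightarrow> int_seq set" where
  "index_set full j = (if full then UNIV else int_seq_plus j)"

lemma in_index_set: "k \<in> index_set full j \<longleftrightarrow> full \<or> Poly_Mapping.lookup k j \<ge> -1 \<and>
    (\<forall>i. i \<noteq> j \<longrightarrow> Poly_Mapping.lookup k i \<ge> 0)"
  by (auto simp: index_set_def int_seq_plus_def)

lemma units_in_index_set:
  "0 \<in> index_set full j" "\<epsilon> i \<in> index_set full j" "- \<epsilon> i \<in> index_set full i"
  by (auto simp: in_index_set lookup_single when_def)

text \<open>The flag \<open>full\<close> distinguishes \<open>W\<^sub>\<infinity>\<close> from \<open>W\<^sub>\<infinity>\<^sup>+\<close>, so that both parts of the theorem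
  share one argument. The last two premises of the bracket identity concern basis elements outside
  the subalgebra, where the values of \<open>\<phi>\<close> are meaningless: these may occur only with coefficient 0.\<close>

locale witt_cocycle =
  fixes full :: bool and \<phi> :: "int_seq \<Rightarrow> nat \<Rightarrow> cpoly"
  assumes cocycle_0: "\<phi> 0 j = pvar j"
    and cocycle_bracket: "r \<in> index_set full i \<Longrightarrow> s \<in> index_set full j \<Longrightarrow>
      (Poly_Mapping.lookup s i \<noteq> 0 \<Longrightarrow> r + s \<in> index_set full j) \<Longrightarrow>
      (Poly_Mapping.lookup r j \<noteq> 0 \<Longrightarrow> r + s \<in> index_set full i) \<Longrightarrow>
      \<phi> r i * pshift r (\<phi> s j) - \<phi> s j * pshift s (\<phi> r i) =
      of_int (Poly_Mapping.lookup s i) * \<phi> (r + s) j - of_int (Poly_Mapping.lookup r j) * \<phi> (r + s) i"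
begin

lemma raise_lower:
  assumes "i \<noteq> j"
  shows "\<phi> (- \<epsilon> i) i * pshift (- \<epsilon> i) (\<phi> (\<epsilon> i) j) - \<phi> (\<epsilon> i) j * pshift (\<epsilon> i) (\<phi> (- \<epsilon> i) i) = pvar j"
  using cocycle_bracket[of "- \<epsilon> i" i "\<epsilon> i" j] assms units_in_index_set
  by (simp add: lookup_single when_def cocycle_0)

lemma raise_raise:
  assumes "i \<noteq> j" "i \<noteq> l"
  shows "\<phi> (\<epsilon> i) j * pshift (\<epsilon> i) (\<phi> (\<epsilon> i) l) = \<phi> (\<epsilon> i) l * pshift (\<epsilon> i) (\<phi> (\<epsilon> i) j)"
  using cocycle_bracket[of "\<epsilon> i" j "\<epsilon> i" l] assms units_in_index_set
  by (simp add: lookup_single when_def)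

lemma lower_lower:
  assumes "i \<noteq> l"
  shows "\<phi> (- \<epsilon> i) i * pshift (- \<epsilon> i) (\<phi> (- \<epsilon> l) l) = \<phi> (- \<epsilon> l) l * pshift (- \<epsilon> l) (\<phi> (- \<epsilon> i) i)"
  using cocycle_bracket[of "- \<epsilon> i" i "- \<epsilon> l" l] assms units_in_index_set
  by (simp add: lookup_single when_def)

lemma lower_raise_commute:
  assumes "l \<noteq> i" "l \<noteq> j"
  shows "\<phi> (- \<epsilon> l) l * pshift (- \<epsilon> l) (\<phi> (\<epsilon> i) j) = \<phi> (\<epsilon> i) j * pshift (\<epsilon> i) (\<phi> (- \<epsilon> l) l)"
  using cocycle_bracket[of "- \<epsilon> l" l "\<epsilon> i" j] assms units_in_index_set
  by (simp add: lookup_single when_def)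

text \<open>For \<open>h\<^sub>m = \<phi>(-\<epsilon> i, i) \<sigma>\<^sub>i\<^sup>-\<^sup>1\<phi>(\<epsilon> i, m)\<close> the relation \<open>[D\<^sub>i, t\<^sub>i \<partial>\<^sub>m] = \<partial>\<^sub>m\<close> reads
  \<open>h\<^sub>m - \<sigma>\<^sub>i h\<^sub>m = x\<^sub>m\<close>. Commutation of \<open>t\<^sub>i \<partial>\<^sub>j\<close> and \<open>t\<^sub>i \<partial>\<^sub>l\<close> makes
  \<open>(h\<^sub>j, h\<^sub>l)\<close> proportional both to \<open>(\<phi>(\<epsilon> i, j), \<phi>(\<epsilon> i, l))\<close> and to its own shift, which
  it exceeds by \<open>(x\<^sub>j, x\<^sub>l)\<close>.\<close>

lemma raise_proportional:
  assumes "i \<noteq> j" "i \<noteq> l"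
  shows "pvar l * \<phi> (\<epsilon> i) j = pvar j * \<phi> (\<epsilon> i) l"
proof -
  define h where "h m = \<phi> (- \<epsilon> i) i * pshift (- \<epsilon> i) (\<phi> (\<epsilon> i) m)" for m
  have diff: "pshift (\<epsilon> i) (h m) = h m - pvar m" if "i \<noteq> m" for m
  proof -
    have "pshift (\<epsilon> i) (h m) = \<phi> (\<epsilon> i) m * pshift (\<epsilon> i) (\<phi> (- \<epsilon> i) i)"
      by (simp add: h_def mult.commute)
    moreover have "h m - \<phi> (\<epsilon> i) m * pshift (\<epsilon> i) (\<phi> (- \<epsilon> i) i) = pvar m"
      using raise_lower[OF that] by (simp add: h_def)
    ultimately show ?thesis by (simp add: algebra_simps)
  qed
  have nz: "h j \<noteq> 0"
    using diff[OF assms(1)] by auto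
  have comm: "h j * \<phi> (\<epsilon> i) l = h l * \<phi> (\<epsilon> i) j"
  proof -
    have "pshift (- \<epsilon> i) (\<phi> (\<epsilon> i) j) * \<phi> (\<epsilon> i) l = pshift (- \<epsilon> i) (\<phi> (\<epsilon> i) l) * \<phi> (\<epsilon> i) j"
      using arg_cong[OF raise_raise[OF assms], of "pshift (- \<epsilon> i)"] by simp
    then show ?thesis by (simp add: h_def mult.assoc)
  qed
  have "h j * pshift (\<epsilon> i) (h l) = pshift (\<epsilon> i) (\<phi> (- \<epsilon> i) i) * (h j * \<phi> (\<epsilon> i) l)"
    by (simp add: h_def)
  also have "\<dots> = h l * pshift (\<epsilon> i) (h j)"
    unfolding comm by (simp add: h_def)
  finally have "h j * (h l - pvar l) = h l * (h j - pvar j)"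
    using diff assms by simp
  then have "h j * pvar l = h l * pvar j"
    by (simp add: algebra_simps)
  then have "h j * (pvar l * \<phi> (\<epsilon> i) j) = h j * (pvar j * \<phi> (\<epsilon> i) l)"
    using comm by (metis (no_types, lifting) mult.assoc mult.commute)
  then show ?thesis using nz by simp
qed

lemma raise_factor_exists:
  "\<exists>\<theta>. (\<forall>j. j \<noteq> i \<longrightarrow> \<phi> (\<epsilon> i) j = pvar j * \<theta>) \<and>
       \<phi> (- \<epsilon> i) i * pshift (- \<epsilon> i) \<theta> - \<theta> * pshift (\<epsilon> i) (\<phi> (- \<epsilon> i) i) = 1"
proof -
  define j where "j = Suc i"
  define l where "l = Suc j"
  have jl: "i \<noteq> j" "i \<noteq> l" "j \<noteq> l" by (simp_all add: j_def l_def)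
  obtain \<theta> where \<theta>: "\<phi> (\<epsilon> i) j = pvar j * \<theta>"
    using pvar_prime_relation[OF raise_proportional[OF jl(1,2)] jl(3)] by metis
  have all: "\<phi> (\<epsilon> i) m = pvar m * \<theta>" if "m \<noteq> i" for m
  proof -
    have "pvar j * (pvar m * \<theta>) = pvar j * \<phi> (\<epsilon> i) m"
      using raise_proportional[OF jl(1), of m] that \<theta> by (simp add: ac_simps)
    then show ?thesis by simp
  qed
  have "pvar j * (\<phi> (- \<epsilon> i) i * pshift (- \<epsilon> i) \<theta> - \<theta> * pshift (\<epsilon> i) (\<phi> (- \<epsilon> i) i)) = pvar j * 1"
    using raise_lower[OF jl(1)] jl(1) unfolding \<theta> by (simp add: lookup_single when_def algebra_simps)
  then have "\<phi> (- \<epsilon> i) i * pshift (- \<epsilon> i) \<theta> - \<theta> * pshift (\<epsilon> i) (\<phi> (- \<epsilon> i) i) = 1"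
    by (simp only: mult_cancel_left pvar_neq_0) simp
  then show ?thesis using all by blast
qed

definition raise_factor :: "nat \<Rightarrow> cpoly" where
  "raise_factor i = (SOME \<theta>. (\<forall>j. j \<noteq> i \<longrightarrow> \<phi> (\<epsilon> i) j = pvar j * \<theta>) \<and>
       \<phi> (- \<epsilon> i) i * pshift (- \<epsilon> i) \<theta> - \<theta> * pshift (\<epsilon> i) (\<phi> (- \<epsilon> i) i) = 1)"

lemma raise_eq: "j \<noteq> i \<Longrightarrow> \<phi> (\<epsilon> i) j = pvar j * raise_factor i"
  and raise_factor_lower:
  "\<phi> (- \<epsilon> i) i * pshift (- \<epsilon> i) (raise_factor i) - raise_factor i * pshift (\<epsilon> i) (\<phi> (- \<epsilon> i) i) = 1"
  using someI_ex[OF raise_factor_exists[of i]] unfolding raise_factor_def by blast+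

lemma lower_nonzero: "\<phi> (- \<epsilon> i) i \<noteq> 0"
  using raise_factor_lower[of i] by auto

text \<open>Let \<open>h\<close> be the product on the left. Invariance of \<open>h - x\<^sub>i\<close> under \<open>\<sigma>\<^sub>i\<close> is
  \<open>raise_factor_lower\<close>. For \<open>l \<noteq> i\<close>, commutation of \<open>D\<^sub>l\<close> with \<open>D\<^sub>i\<close> and with \<open>t\<^sub>i \<partial>\<^sub>j\<close>
  yields \<open>\<phi>(-\<epsilon> l, l) \<sigma>\<^sub>l\<^sup>-\<^sup>1h = \<phi>(-\<epsilon> l, l) h\<close>, where the first factor can be cancelled.\<close>

lemma lower_raise_factor_linear:
  obtains \<alpha> where "\<phi> (- \<epsilon> i) i * pshift (- \<epsilon> i) (raise_factor i) = pvar i + pconst \<alpha>"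
proof -
  define h where "h = \<phi> (- \<epsilon> i) i * pshift (- \<epsilon> i) (raise_factor i)"
  have "pshift (\<epsilon> l) (h - pvar i) = h - pvar i" for l
  proof (cases "l = i")
    case True
    have "pshift (\<epsilon> i) h = raise_factor i * pshift (\<epsilon> i) (\<phi> (- \<epsilon> i) i)"
      by (simp add: h_def mult.commute)
    also have "\<dots> = h - 1"
      using raise_factor_lower[of i] by (simp add: h_def algebra_simps)
    finally show ?thesis using True by simp
  next
    case False
    define j where "j = Suc (i + l)"
    have j: "l \<noteq> j" "j \<noteq> i" by (auto simp: j_def)
    define D where "D = \<phi> (- \<epsilon> l) l"
    have "pvar j * (D * pshift (- \<epsilon> l) (raise_factor i)) = pvar j * (raise_factor i * pshift (\<epsilon> i) D)"
      using lower_raise_commute[OF False j(1)] j unfolding raise_eq[OF j(2)] D_def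
      by (simp add: lookup_single when_def algebra_simps)
    then have "D * pshift (- \<epsilon> l) (raise_factor i) = raise_factor i * pshift (\<epsilon> i) D" by simp
    from arg_cong[OF this, of "pshift (- \<epsilon> i)"]
    have 1: "pshift (- \<epsilon> i) D * pshift (- \<epsilon> i - \<epsilon> l) (raise_factor i) = pshift (- \<epsilon> i) (raise_factor i) * D"
      by simp
    have 2: "\<phi> (- \<epsilon> i) i * pshift (- \<epsilon> i) D = D * pshift (- \<epsilon> l) (\<phi> (- \<epsilon> i) i)"
      using lower_lower[of i l] False by (simp add: D_def)
    have "D * pshift (- \<epsilon> l) h = (D * pshift (- \<epsilon> l) (\<phi> (- \<epsilon> i) i)) * pshift (- \<epsilon> i - \<epsilon> l) (raise_factor i)"
      by (simp add: h_def mult.assoc minus_diff_commute)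
    also have "\<dots> = \<phi> (- \<epsilon> i) i * (pshift (- \<epsilon> i) D * pshift (- \<epsilon> i - \<epsilon> l) (raise_factor i))"
      unfolding 2[symmetric] by (simp only: mult.assoc)
    also have "\<dots> = D * h"
      unfolding 1 by (simp add: h_def ac_simps)
    finally have "pshift (- \<epsilon> l) h = h"
      using lower_nonzero[of l] by (simp add: D_def)
    then have "pshift (\<epsilon> l) h = h" by (simp add: pshift_invariant_uminus)
    then show ?thesis using False by (simp add: lookup_single when_def)
  qed
  then obtain \<alpha> where "h - pvar i = pconst \<alpha>" by (rule pshift_invariant_imp_const)
  then show ?thesis using that[of \<alpha>] by (simp add: h_def algebra_simps)
qed

text \<open>The set \<open>S\<close> consists of the indices whose lowering factor is constant. At these the raising
  factor is linear, at the others it is the constant \<open>\<Lambda> i\<close>.\<close>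

lemma lower_raise_normal_form:
  obtains \<Lambda> :: "nat \<Rightarrow> complex" and a and S where "\<And>i. \<Lambda> i \<noteq> 0"
    "\<And>i. \<phi> (- \<epsilon> i) i = pconst (inverse (\<Lambda> i)) * (if i \<in> S then 1 else pvar i + pconst (a + 1))"
    "\<And>i j. j \<noteq> i \<Longrightarrow> \<phi> (\<epsilon> i) j = pvar j * (pconst (\<Lambda> i) * (if i \<in> S then pvar i + pconst a else 1))"
proof -
  have "\<forall>i. \<exists>\<alpha>. \<phi> (- \<epsilon> i) i * pshift (- \<epsilon> i) (raise_factor i) = pvar i + pconst \<alpha>"
    using lower_raise_factor_linear by metis
  then obtain \<alpha> where lr: "\<And>i. \<phi> (- \<epsilon> i) i * pshift (- \<epsilon> i) (raise_factor i) = pvar i + pconst (\<alpha> i)"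
    by metis
  have rl: "raise_factor i * pshift (\<epsilon> i) (\<phi> (- \<epsilon> i) i) = pvar i + pconst (\<alpha> i) - 1" for i
    using lr[of i] raise_factor_lower[of i] by (simp add: algebra_simps)
  define S where "S = {i. \<exists>d. \<phi> (- \<epsilon> i) i = pconst d}"
  have "\<exists>c. c \<noteq> 0 \<and> \<phi> (- \<epsilon> i) i = pconst (inverse c) * (if i \<in> S then 1 else pvar i + pconst (\<alpha> i)) \<and>
      raise_factor i = pconst c * (if i \<in> S then pvar i + pconst (\<alpha> i - 1) else 1)" for i
  proof (cases "i \<in> S")
    case True
    then obtain d where d: "\<phi> (- \<epsilon> i) i = pconst d" by (auto simp: S_def)
    with lower_nonzero[of i] have d0: "d \<noteq> 0" by (auto simp: pconst_simps)
    have "pconst (inverse d) * (pconst d * raise_factor i) = pconst (inverse d) * (pvar i + pconst (\<alpha> i) - 1)"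
      using rl[of i] by (simp add: d mult.commute)
    then have "raise_factor i = pconst (inverse d) * (pvar i + pconst (\<alpha> i - 1))"
      using d0 by (simp add: mult.assoc[symmetric] pconst_simps(4)[symmetric] pconst_simps(2,6) algebra_simps)
    then show ?thesis using True d d0 by (intro exI[of _ "inverse d"]) simp
  next
    case False
    then obtain c where c: "pshift (- \<epsilon> i) (raise_factor i) = pconst c"
      using linear_factor_const[OF lr[of i]] by (auto simp: S_def)
    have r: "raise_factor i = pconst c"
      using arg_cong[OF c, of "pshift (\<epsilon> i)"] by simp
    have c0: "c \<noteq> 0" using lr[of i] pvar_neq_pconst[of i "- \<alpha> i"] by (auto simp: r pconst_simps eq_neg_iff_add_eq_0)
    have "pconst (inverse c) * (pconst c * \<phi> (- \<epsilon> i) i) = pconst (inverse c) * (pvar i + pconst (\<alpha> i))"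
      using lr[of i] by (simp add: r mult.commute)
    then have "\<phi> (- \<epsilon> i) i = pconst (inverse c) * (pvar i + pconst (\<alpha> i))"
      using c0 by (simp add: mult.assoc[symmetric] pconst_simps(4)[symmetric] pconst_simps(2))
    then show ?thesis using False r c0 by (intro exI[of _ c]) simp
  qed
  then obtain \<Lambda> where \<Lambda>: "\<And>i. \<Lambda> i \<noteq> 0"
    "\<And>i. \<phi> (- \<epsilon> i) i = pconst (inverse (\<Lambda> i)) * (if i \<in> S then 1 else pvar i + pconst (\<alpha> i))"
    "\<And>i. raise_factor i = pconst (\<Lambda> i) * (if i \<in> S then pvar i + pconst (\<alpha> i - 1) else 1)"
    by metis
  have Dinv: "pshift r (\<phi> (- \<epsilon> i) i) = \<phi> (- \<epsilon> i) i" if "Poly_Mapping.lookup r i = 0" for r i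
    using that by (simp add: \<Lambda>(2))
  have Rinv: "pshift r (raise_factor i) = raise_factor i" if "Poly_Mapping.lookup r i = 0" for r i
    using that by (simp add: \<Lambda>(3))
  \<comment> \<open>The value at \<open>t\<^sub>i D\<^sub>l = [D\<^sub>l, t\<^sub>i \<partial>\<^sub>l]\<close>.\<close>
  have mixed: "\<phi> (\<epsilon> i - \<epsilon> l) l = \<phi> (- \<epsilon> l) l * raise_factor i" if "i \<noteq> l" for i l
  proof -
    have "\<epsilon> i - \<epsilon> l \<in> index_set full l"
      using that by (auto simp: in_index_set lookup_single when_def lookup_minus)
    then have "\<phi> (- \<epsilon> l) l * pshift (- \<epsilon> l) (\<phi> (\<epsilon> i) l) - \<phi> (\<epsilon> i) l * pshift (\<epsilon> i) (\<phi> (- \<epsilon> l) l)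
        = \<phi> (\<epsilon> i - \<epsilon> l) l"
      using cocycle_bracket[of "- \<epsilon> l" l "\<epsilon> i" l] that units_in_index_set by (simp add: lookup_single when_def)
    then show ?thesis
      using that by (simp add: raise_eq Rinv Dinv lookup_single when_def algebra_simps)
  qed
  have "\<alpha> i = \<alpha> l" if il: "i \<noteq> l" for i l
  proof -
    \<comment> \<open>The bracket \<open>[t\<^sub>i D\<^sub>l, t\<^sub>l D\<^sub>i] = \<partial>\<^sub>i - \<partial>\<^sub>l\<close> compares the constants of \<open>i\<close> and \<open>l\<close>.\<close>
    have m: "\<epsilon> i - \<epsilon> l \<in> index_set full l" "\<epsilon> l - \<epsilon> i \<in> index_set full i"
      using that by (auto simp: in_index_set lookup_single when_def lookup_minus)
    let ?Di = "\<phi> (- \<epsilon> i) i" and ?Dl = "\<phi> (- \<epsilon> l) l"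
    let ?Ri = "raise_factor i" and ?Rl = "raise_factor l"
    have A: "pshift (\<epsilon> i - \<epsilon> l) (?Di * ?Rl) = pshift (\<epsilon> i) ?Di * pshift (- \<epsilon> l) ?Rl"
    proof -
      have "pshift (\<epsilon> i) (pshift (- \<epsilon> l) (?Di * ?Rl)) = pshift (\<epsilon> i) ?Di * pshift (- \<epsilon> l) (pshift (\<epsilon> i) ?Rl)"
        using Dinv[of "- \<epsilon> l" i] il by (simp add: lookup_single when_def add.commute)
      then show ?thesis using Rinv[of "\<epsilon> i" l] il by (simp add: lookup_single when_def)
    qed
    have B: "pshift (\<epsilon> l - \<epsilon> i) (?Dl * ?Ri) = pshift (\<epsilon> l) ?Dl * pshift (- \<epsilon> i) ?Ri"
    proof -
      have "pshift (\<epsilon> l) (pshift (- \<epsilon> i) (?Dl * ?Ri)) = pshift (\<epsilon> l) ?Dl * pshift (- \<epsilon> i) (pshift (\<epsilon> l) ?Ri)"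
        using Dinv[of "- \<epsilon> i" l] il by (simp add: lookup_single when_def add.commute)
      then show ?thesis using Rinv[of "\<epsilon> l" i] il by (simp add: lookup_single when_def)
    qed
    have "(?Dl * ?Ri) * pshift (\<epsilon> i - \<epsilon> l) (?Di * ?Rl) - (?Di * ?Rl) * pshift (\<epsilon> l - \<epsilon> i) (?Dl * ?Ri)
        = pvar i - pvar l"
      using cocycle_bracket[OF m] il units_in_index_set
      by (simp add: mixed lookup_single when_def lookup_minus cocycle_0)
    then have "(?Dl * pshift (- \<epsilon> l) ?Rl) * (?Ri * pshift (\<epsilon> i) ?Di)
        - (?Di * pshift (- \<epsilon> i) ?Ri) * (?Rl * pshift (\<epsilon> l) ?Dl) = pvar i - pvar l"
      unfolding A B by (simp only: ac_simps)
    then have "pconst (\<alpha> i) = pconst (\<alpha> l)"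
      unfolding lr rl by (simp add: algebra_simps)
    then show ?thesis by simp
  qed
  then have \<alpha>: "\<alpha> i = \<alpha> 0" for i by (cases "i = 0") auto
  show ?thesis
  proof (rule that[of \<Lambda> S "\<alpha> 0 - 1"])
    show "\<phi> (- \<epsilon> i) i = pconst (inverse (\<Lambda> i)) * (if i \<in> S then 1 else pvar i + pconst (\<alpha> 0 - 1 + 1))" for i
      using \<Lambda>(2)[of i] \<alpha>[of i] by simp
    show "\<phi> (\<epsilon> i) j = pvar j * (pconst (\<Lambda> i) * (if i \<in> S then pvar i + pconst (\<alpha> 0 - 1) else 1))" if "j \<noteq> i" for i j
      using raise_eq[OF that] \<Lambda>(3)[of i] \<alpha>[of i] by simp
  qed (rule \<Lambda>)
qed

end

section \<open>Determination of a cocycle by its lowering and raising operators\<close>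

locale normalised_cocycle = witt_cocycle +
  fixes \<Lambda> :: "nat \<Rightarrow> complex" and a :: complex and S :: "nat set"
  assumes \<Lambda>_nonzero: "\<Lambda> i \<noteq> 0"
    and lower_normal: "\<phi> (- \<epsilon> i) i = pconst (inverse (\<Lambda> i)) * (if i \<in> S then 1 else pvar i + pconst (a + 1))"
    and raise_normal: "j \<noteq> i \<Longrightarrow>
      \<phi> (\<epsilon> i) j = pvar j * (pconst (\<Lambda> i) * (if i \<in> S then pvar i + pconst a else 1))"
begin

text \<open>The exponents at which \<open>\<phi>(k, j) = (x\<^sub>j - k\<^sub>j(a + 1)) \<Theta>(k)\<close> is going to hold for every \<open>j\<close>.
  When \<open>S\<close> is nonempty, the multiplicativity \<open>\<Theta>_add\<close> fails for negative exponents.\<close>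

definition regular :: "int_seq \<Rightarrow> bool" where
  "regular k \<longleftrightarrow> full \<and> S = {} \<or> (\<forall>i. Poly_Mapping.lookup k i \<ge> 0)"

definition \<Theta> :: "int_seq \<Rightarrow> cpoly" where
  "\<Theta> k = pconst (seq_power \<Lambda> k) * phi_prod S a k"

text \<open>The induction runs over those \<open>j\<close> with \<open>k\<^sub>j = 0\<close> only; \<open>settled_formula\<close> recovers the
  others at the end.\<close>

definition settled :: "int_seq \<Rightarrow> bool" where
  "settled k \<longleftrightarrow> regular k \<and> (\<forall>j. Poly_Mapping.lookup k j = 0 \<longrightarrow> \<phi> k j = pvar j * \<Theta> k)"

lemma settledD: "settled k \<Longrightarrow> Poly_Mapping.lookup k j = 0 \<Longrightarrow> \<phi> k j = pvar j * \<Theta> k"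
  by (simp add: settled_def)

lemma settled_regular: "settled k \<Longrightarrow> regular k"
  by (simp add: settled_def)

lemma \<Theta>_0: "\<Theta> 0 = 1"
  by (simp add: \<Theta>_def phi_prod_0 seq_power_def pconst_simps)

lemma \<Theta>_add: "regular k \<Longrightarrow> regular r \<Longrightarrow> \<Theta> (k + r) = \<Theta> k * pshift k (\<Theta> r)"
  unfolding regular_def \<Theta>_def seq_power_add[of \<Lambda>, OF \<Lambda>_nonzero]
  by (auto simp: phi_prod_empty phi_prod_add pconst_simps)

lemma \<Theta>_pshift:
  assumes "Poly_Mapping.lookup k l = 0"
  shows "pshift (\<epsilon> l) (\<Theta> k) = \<Theta> k" "pshift (- \<epsilon> l) (\<Theta> k) = \<Theta> k"
proof -
  have "pshift (\<epsilon> l) (phi_prod S a k) = phi_prod S a k" using assms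
    by (intro phi_prod_pshift_disjoint) (auto simp: lookup_single when_def in_keys_iff)
  then show "pshift (\<epsilon> l) (\<Theta> k) = \<Theta> k" by (simp add: \<Theta>_def)
  then show "pshift (- \<epsilon> l) (\<Theta> k) = \<Theta> k" by (simp add: pshift_invariant_uminus)
qed

lemma \<Theta>_e: "\<Theta> (\<epsilon> l) = pconst (\<Lambda> l) * (if l \<in> S then pvar l + pconst a else 1)"
  by (simp add: \<Theta>_def seq_power_single phi_prod_single)

lemma raise_\<Theta>: "j \<noteq> l \<Longrightarrow> \<phi> (\<epsilon> l) j = pvar j * \<Theta> (\<epsilon> l)"
  by (simp add: raise_normal \<Theta>_e)

lemma \<Theta>_e_pshift: "Poly_Mapping.lookup r l = 0 \<Longrightarrow> pshift r (\<Theta> (\<epsilon> l)) = \<Theta> (\<epsilon> l)"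
  by (simp add: \<Theta>_e)

lemma lower_pshift: "Poly_Mapping.lookup r l = 0 \<Longrightarrow> pshift r (\<phi> (- \<epsilon> l) l) = \<phi> (- \<epsilon> l) l"
  by (simp add: lower_normal)

lemma pconst_inverse_\<Lambda>: "pconst (inverse (\<Lambda> l)) * (pconst (\<Lambda> l) * p) = p"
  by (simp add: mult.assoc[symmetric] pconst_simps(4)[symmetric] pconst_simps(2) \<Lambda>_nonzero)

lemma pconst_\<Lambda>_inverse: "pconst (\<Lambda> l) * pconst (inverse (\<Lambda> l)) = 1"
  by (simp add: pconst_simps(4)[symmetric] pconst_simps(2) \<Lambda>_nonzero)

lemma lower_raise_normal: "\<phi> (- \<epsilon> l) l * pshift (- \<epsilon> l) (\<Theta> (\<epsilon> l)) = pvar l + pconst (a + 1)"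
  by (simp add: lower_normal \<Theta>_e pconst_inverse_\<Lambda> pconst_\<Lambda>_inverse pconst_simps ac_simps)

lemma raise_lower_normal: "\<Theta> (\<epsilon> l) * pshift (\<epsilon> l) (\<phi> (- \<epsilon> l) l) = pvar l + pconst a"
proof -
  have "\<Theta> (\<epsilon> l) * pshift (\<epsilon> l) (\<phi> (- \<epsilon> l) l) = pshift (\<epsilon> l) (\<phi> (- \<epsilon> l) l * pshift (- \<epsilon> l) (\<Theta> (\<epsilon> l)))"
    by (simp add: mult.commute)
  then show ?thesis unfolding lower_raise_normal by (simp add: pconst_simps)
qed

lemma regular_e: "regular (\<epsilon> l)" "regular 0"
  by (auto simp: regular_def lookup_single when_def)

lemma regular_add: "regular k \<Longrightarrow> regular r \<Longrightarrow> regular (k + r)"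
  by (auto simp: regular_def lookup_add)

lemma regular_index: "regular k \<Longrightarrow> k \<in> index_set full j"
  by (auto simp: regular_def in_index_set intro: order_trans[of "-1" "0::int"])

lemma regular_index_lower: "regular k \<Longrightarrow> k - \<epsilon> l \<in> index_set full l"
  by (auto simp: regular_def in_index_set lookup_minus lookup_single when_def dest: spec[of _ l])

text \<open>Read off from \<open>[D\<^sub>l, t\<^sup>k \<partial>\<^sub>l] = t\<^sup>k D\<^sub>l\<close>.\<close>

lemma settled_lower:
  assumes "settled k" "Poly_Mapping.lookup k l = 0"
  shows "\<phi> (k - \<epsilon> l) l = \<phi> (- \<epsilon> l) l * \<Theta> k"
proof -
  have reg: "regular k" using assms by (simp add: settled_def)
  have "\<phi> (- \<epsilon> l) l * pshift (- \<epsilon> l) (\<phi> k l) - \<phi> k l * pshift k (\<phi> (- \<epsilon> l) l) = \<phi> (k - \<epsilon> l) l"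
    using cocycle_bracket[of "- \<epsilon> l" l k l] units_in_index_set regular_index[OF reg] regular_index_lower[OF reg] assms(2)
    by (simp add: lookup_single when_def)
  moreover have "pshift (- \<epsilon> l) (\<phi> k l) = (pvar l + 1) * \<Theta> k"
    using assms by (simp add: settledD \<Theta>_pshift)
  ultimately show ?thesis
    using assms by (simp add: settledD \<Theta>_pshift lower_pshift algebra_simps)
qed

text \<open>Read off from \<open>[t\<^sup>k \<partial>\<^sub>l, t\<^sub>l \<partial>\<^sub>j] = t\<^sup>k t\<^sub>l \<partial>\<^sub>j\<close>.\<close>

lemma settled_raise:
  assumes "settled k" "Poly_Mapping.lookup k l = 0" "Poly_Mapping.lookup k j = 0" "j \<noteq> l"
  shows "\<phi> (k + \<epsilon> l) j = pvar j * \<Theta> k * \<Theta> (\<epsilon> l)"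
proof -
  have reg: "regular k" using assms by (simp add: settled_def)
  have "\<phi> k l * pshift k (\<phi> (\<epsilon> l) j) - \<phi> (\<epsilon> l) j * pshift (\<epsilon> l) (\<phi> k l) = \<phi> (k + \<epsilon> l) j"
    using cocycle_bracket[of k l "\<epsilon> l" j] units_in_index_set regular_index[OF reg] assms
      regular_index[OF regular_add[OF reg regular_e(1)]]
    by (simp add: lookup_single when_def)
  moreover have "pshift k (\<phi> (\<epsilon> l) j) = pvar j * \<Theta> (\<epsilon> l)"
    using assms by (simp add: raise_\<Theta> \<Theta>_e_pshift)
  moreover have "pshift (\<epsilon> l) (\<phi> k l) = (pvar l - 1) * \<Theta> k"
    using assms by (simp add: settledD \<Theta>_pshift)
  ultimately show ?thesis
    using assms by (simp add: settledD \<Theta>_pshift raise_\<Theta> algebra_simps)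
qed

lemma fresh_index:
  fixes k s :: int_seq
  obtains l where "Poly_Mapping.lookup k l = 0" "Poly_Mapping.lookup s l = 0" "l \<noteq> j"
proof -
  have "finite (Poly_Mapping.keys k \<union> Poly_Mapping.keys s \<union> {j})" by simp
  then obtain l where "l \<notin> Poly_Mapping.keys k \<union> Poly_Mapping.keys s \<union> {j}"
    using ex_new_if_finite infinite_UNIV_nat by metis
  then show ?thesis using that[of l] by (auto simp: in_keys_iff)
qed

text \<open>For an index \<open>l\<close> outside the supports, \<open>[t\<^sup>k D\<^sub>l, t\<^sup>s t\<^sub>l \<partial>\<^sub>j] = t\<^sup>k\<^sup>+\<^sup>s \<partial>\<^sub>j\<close>. The factors
  belonging to \<open>l\<close> contribute \<open>(x\<^sub>l + a + 1) - (x\<^sub>l + a) = 1\<close>. The last hypothesis excludes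
  cancellation between \<open>k\<^sub>j\<close> and \<open>s\<^sub>j\<close>.\<close>

lemma settled_add:
  assumes k: "settled k" and s: "settled s"
    and same_sign: "\<And>j. Poly_Mapping.lookup (k + s) j = 0 \<Longrightarrow> Poly_Mapping.lookup k j = 0"
  shows "settled (k + s)"
  unfolding settled_def
proof (intro conjI allI impI)
  note reg = k[THEN settled_regular] s[THEN settled_regular]
  show regks: "regular (k + s)" using reg by (rule regular_add)
  fix j assume j: "Poly_Mapping.lookup (k + s) j = 0"
  then have kj: "Poly_Mapping.lookup k j = 0" and sj: "Poly_Mapping.lookup s j = 0"
    using same_sign[OF j] by (auto simp: lookup_add)
  obtain l where l: "Poly_Mapping.lookup k l = 0" "Poly_Mapping.lookup s l = 0" "l \<noteq> j"
    by (rule fresh_index)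
  let ?D = "\<phi> (- \<epsilon> l) l" and ?R = "\<Theta> (\<epsilon> l)"
  have "\<phi> (k - \<epsilon> l) l * pshift (k - \<epsilon> l) (\<phi> (s + \<epsilon> l) j)
      - \<phi> (s + \<epsilon> l) j * pshift (s + \<epsilon> l) (\<phi> (k - \<epsilon> l) l) = \<phi> (k + s) j"
    using cocycle_bracket[of "k - \<epsilon> l" l "s + \<epsilon> l" j] regular_index[OF regks] regular_index_lower[OF reg(1)]
      regular_index[OF regular_add[OF reg(2) regular_e(1)]] l kj sj
    by (simp add: lookup_single when_def lookup_add lookup_minus)
  moreover have "pshift (k - \<epsilon> l) (\<phi> (s + \<epsilon> l) j) = pvar j * pshift k (\<Theta> s) * pshift (- \<epsilon> l) ?R"
  proof -
    have "pshift (k - \<epsilon> l) (\<phi> (s + \<epsilon> l) j) = pshift k (pshift (- \<epsilon> l) (pvar j * \<Theta> s * ?R))"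
      using settled_raise[OF s l(2) sj] l(3)
      by (simp add: lookup_minus lookup_single when_def)
    also have "\<dots> = pvar j * pshift k (\<Theta> s) * pshift (- \<epsilon> l) (pshift k ?R)"
      using l kj by (simp add: \<Theta>_pshift lookup_single lookup_minus when_def add.commute[of k])
    finally show ?thesis using l by (simp add: \<Theta>_e_pshift)
  qed
  moreover have "pshift (s + \<epsilon> l) (\<phi> (k - \<epsilon> l) l) = pshift (\<epsilon> l) ?D * pshift s (\<Theta> k)"
  proof -
    have "pshift (s + \<epsilon> l) (\<phi> (k - \<epsilon> l) l) = pshift s (pshift (\<epsilon> l) (?D * \<Theta> k))"
      using settled_lower[OF k l(1)] by simp
    also have "\<dots> = pshift (\<epsilon> l) (pshift s ?D) * pshift s (\<Theta> k)"
      using l by (simp add: \<Theta>_pshift add.commute[of s])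
    finally show ?thesis using l by (simp add: lower_pshift)
  qed
  ultimately have "(?D * \<Theta> k) * (pvar j * pshift k (\<Theta> s) * pshift (- \<epsilon> l) ?R)
      - (pvar j * \<Theta> s * ?R) * (pshift (\<epsilon> l) ?D * pshift s (\<Theta> k)) = \<phi> (k + s) j"
    using settled_lower[OF k l(1)] settled_raise[OF s l(2) sj] l(3) by simp
  then have "\<phi> (k + s) j = pvar j * ((\<Theta> k * pshift k (\<Theta> s)) * (?D * pshift (- \<epsilon> l) ?R))
      - pvar j * ((\<Theta> s * pshift s (\<Theta> k)) * (?R * pshift (\<epsilon> l) ?D))"
    by (simp only: ac_simps)
  moreover have "\<Theta> s * pshift s (\<Theta> k) = \<Theta> (k + s)" "\<Theta> k * pshift k (\<Theta> s) = \<Theta> (k + s)"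
    using \<Theta>_add[OF reg] \<Theta>_add[OF reg(2,1)] by (simp_all add: add.commute)
  ultimately have "\<phi> (k + s) j = pvar j * (\<Theta> (k + s) * (?D * pshift (- \<epsilon> l) ?R))
      - pvar j * (\<Theta> (k + s) * (?R * pshift (\<epsilon> l) ?D))" by simp
  then show "\<phi> (k + s) j = pvar j * \<Theta> (k + s)"
    unfolding lower_raise_normal raise_lower_normal by (simp add: pconst_simps algebra_simps)
qed

text \<open>For an index \<open>l\<close> outside the support,
  \<open>[t\<^sup>k D\<^sub>l, t\<^sub>l \<partial>\<^sub>j] = t\<^sup>k \<partial>\<^sub>j - k\<^sub>j t\<^sup>k \<partial>\<^sub>l\<close>, and \<open>\<phi>(k, l)\<close> is known since \<open>k\<^sub>l = 0\<close>.\<close>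

lemma settled_formula:
  assumes k: "settled k"
  shows "\<phi> k j = (pvar j - pconst (of_int (Poly_Mapping.lookup k j) * (a + 1))) * \<Theta> k"
proof -
  note reg = k[THEN settled_regular]
  obtain l where l: "Poly_Mapping.lookup k l = 0" "l \<noteq> j"
    by (rule fresh_index)
  let ?D = "\<phi> (- \<epsilon> l) l" and ?R = "\<Theta> (\<epsilon> l)" and ?c = "of_int (Poly_Mapping.lookup k j) :: cpoly"
  have "\<phi> (k - \<epsilon> l) l * pshift (k - \<epsilon> l) (\<phi> (\<epsilon> l) j)
      - \<phi> (\<epsilon> l) j * pshift (\<epsilon> l) (\<phi> (k - \<epsilon> l) l) = \<phi> k j - ?c * \<phi> k l"
    using cocycle_bracket[of "k - \<epsilon> l" l "\<epsilon> l" j] regular_index[OF reg] regular_index_lower[OF reg] l units_in_index_set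
    by (simp add: lookup_single when_def lookup_add lookup_minus)
  moreover have "pshift (k - \<epsilon> l) (\<phi> (\<epsilon> l) j) = (pvar j - ?c) * pshift (- \<epsilon> l) ?R"
  proof -
    have "pshift (k - \<epsilon> l) (\<phi> (\<epsilon> l) j) = pshift (- \<epsilon> l) (pshift k (pvar j * ?R))"
      using l(2) by (simp add: raise_\<Theta> lookup_minus lookup_single when_def)
    then show ?thesis using l by (simp add: \<Theta>_e_pshift lookup_single lookup_minus when_def)
  qed
  moreover have "pshift (\<epsilon> l) (\<phi> (k - \<epsilon> l) l) = pshift (\<epsilon> l) ?D * \<Theta> k"
    using settled_lower[OF k l(1)] l by (simp add: \<Theta>_pshift)
  moreover have "\<phi> k l = pvar l * \<Theta> k" using k l by (simp add: settledD)
  ultimately have "(?D * \<Theta> k) * ((pvar j - ?c) * pshift (- \<epsilon> l) ?R)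
      - (pvar j * ?R) * (pshift (\<epsilon> l) ?D * \<Theta> k) = \<phi> k j - ?c * (pvar l * \<Theta> k)"
    using settled_lower[OF k l(1)] raise_\<Theta>[of j l] l by (simp add: \<Theta>_pshift)
  then have "\<phi> k j = \<Theta> k * (pvar j - ?c) * (?D * pshift (- \<epsilon> l) ?R)
      - \<Theta> k * pvar j * (?R * pshift (\<epsilon> l) ?D) + ?c * (pvar l * \<Theta> k)"
    by (simp add: algebra_simps)
  then show ?thesis
    unfolding lower_raise_normal raise_lower_normal by (simp add: pconst_simps algebra_simps)
qed

lemma settled_0: "settled 0"
  by (auto simp: settled_def regular_e cocycle_0 \<Theta>_0)

lemma settled_e: "settled (\<epsilon> i)"
  by (auto simp: settled_def regular_e raise_\<Theta> lookup_single when_def)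

lemma settled_multiple:
  assumes "settled (Poly_Mapping.single i c)" "c \<noteq> 0"
  shows "settled (Poly_Mapping.single i (int n * c))"
proof (induction n)
  case 0
  then show ?case by (simp add: settled_0)
next
  case (Suc n)
  have "settled (Poly_Mapping.single i (int n * c) + Poly_Mapping.single i c)"
  proof (rule settled_add[OF Suc assms(1)])
    fix j assume "Poly_Mapping.lookup (Poly_Mapping.single i (int n * c) + Poly_Mapping.single i c) j = 0"
    moreover have "int n * c + c \<noteq> 0"
      using assms(2) by (simp add: distrib_right[of "int n" 1 c, simplified, symmetric])
    ultimately show "Poly_Mapping.lookup (Poly_Mapping.single i (int n * c)) j = 0"
      by (auto simp: lookup_add lookup_single when_def)
  qed
  moreover have "Poly_Mapping.single i (int n * c) + Poly_Mapping.single i c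
      = Poly_Mapping.single i (int (Suc n) * c)"
    by (simp add: distrib_right add.commute flip: single_add)
  ultimately show ?case by simp
qed

lemma settled_if_single_settled:
  assumes "\<And>i c. regular (Poly_Mapping.single i c) \<Longrightarrow> settled (Poly_Mapping.single i c)"
  shows "regular k \<Longrightarrow> settled k"
proof (induction k rule: Poly_Mapping.update_induct)
  case const
  show ?case by (rule settled_0)
next
  case (update f i c)
  have eq: "Poly_Mapping.update i c f = f + Poly_Mapping.single i c"
    using update(1)
    by (intro poly_mapping_eqI)
       (auto simp: lookup_update lookup_add lookup_single when_def in_keys_iff)
  have fi: "Poly_Mapping.lookup f i = 0" using update(1) by (simp add: in_keys_iff)
  have "regular f \<and> regular (Poly_Mapping.single i c)"
  proof (cases "full \<and> S = {}")
    case True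
    then show ?thesis unfolding regular_def by blast
  next
    case False
    then have nonneg: "0 \<le> Poly_Mapping.lookup (Poly_Mapping.update i c f) j" for j
      using update(4) unfolding regular_def by blast
    have "0 \<le> Poly_Mapping.lookup f j" for j
      using nonneg[of j] fi by (cases "j = i") (simp_all add: lookup_update)
    moreover have "0 \<le> c" using nonneg[of i] by (simp add: lookup_update)
    ultimately show ?thesis by (simp add: regular_def lookup_single when_def)
  qed
  then have "settled f" "settled (Poly_Mapping.single i c)"
    using update(3) assms by auto
  then show ?case unfolding eq
    by (rule settled_add) (use fi update(2) in \<open>auto simp: lookup_add lookup_single when_def split: if_splits\<close>)
qed

text \<open>In \<open>W\<^sub>\<infinity>\<close> let \<open>\<eta>\<close> be the polynomial of \<open>t\<^sub>i\<^sup>-\<^sup>1 \<partial>\<^sub>l\<close>. The brackets with \<open>t\<^sub>i \<partial>\<^sub>j\<close>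
  (which is 0) and with \<open>t\<^sub>i \<partial>\<^sub>i\<close> (which is \<open>- \<partial>\<^sub>l\<close>) combine to
  \<open>\<eta> \<sigma>\<^sub>i\<^sup>-\<^sup>1\<theta>\<^sub>i = x\<^sub>l\<close>, where \<open>\<theta>\<^sub>i = \<Theta>(\<epsilon> i)\<close>. If \<open>\<theta>\<^sub>i\<close> were linear in \<open>x\<^sub>i\<close>, the left
  side would vanish at a point with \<open>x\<^sub>l = 1\<close>.\<close>

lemma full_imp_S_empty:
  assumes full: full
  shows "S = {}" and "l \<noteq> i \<Longrightarrow> \<phi> (- \<epsilon> i) l = pvar l * pconst (inverse (\<Lambda> i))"
proof -
  have idx: "k \<in> index_set full m" for k m using full by (simp add: in_index_set)
  have main: "\<phi> (- \<epsilon> i) l * pshift (- \<epsilon> i) (\<Theta> (\<epsilon> i)) = pvar l" if "l \<noteq> i" for i l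
  proof -
    define j where "j = Suc (i + l)"
    have j: "j \<noteq> i" "j \<noteq> l" by (auto simp: j_def)
    let ?\<eta> = "\<phi> (- \<epsilon> i) l" and ?R = "\<Theta> (\<epsilon> i)"
    have "pvar j * (?R * pshift (\<epsilon> i) ?\<eta>) = pvar j * (?\<eta> * pshift (- \<epsilon> i) ?R)"
      using cocycle_bracket[OF idx idx idx idx, of "\<epsilon> i" j "- \<epsilon> i" l] j that
      by (simp add: raise_\<Theta> lookup_single when_def algebra_simps)
    then have comm: "?R * pshift (\<epsilon> i) ?\<eta> = ?\<eta> * pshift (- \<epsilon> i) ?R" by simp
    have "\<phi> (\<epsilon> i) i = (pvar i - pconst (a + 1)) * ?R"
      using settled_formula[OF settled_e, of i i] by simp
    then have "((pvar i - pconst (a + 1)) * ?R) * pshift (\<epsilon> i) ?\<eta>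
        - ?\<eta> * ((pvar i + 1 - pconst (a + 1)) * pshift (- \<epsilon> i) ?R) = - pvar l"
      using cocycle_bracket[OF idx idx idx idx, of "\<epsilon> i" i "- \<epsilon> i" l] that
      by (simp add: lookup_single when_def cocycle_0)
    then have "(pvar i - pconst (a + 1)) * (?R * pshift (\<epsilon> i) ?\<eta>)
        - (pvar i + 1 - pconst (a + 1)) * (?\<eta> * pshift (- \<epsilon> i) ?R) = - pvar l"
      by (simp only: ac_simps)
    then show ?thesis unfolding comm by (simp add: algebra_simps)
  qed
  have notin: "i \<notin> S" for i
  proof
    assume "i \<in> S"
    define \<sigma> where "\<sigma> = (\<lambda>m. if m = i then pconst (- (a + 1)) else 1 :: cpoly)"
    have "psubst \<sigma> (\<phi> (- \<epsilon> i) (Suc i) * pshift (- \<epsilon> i) (\<Theta> (\<epsilon> i))) = psubst \<sigma> (pvar (Suc i))"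
      by (rule arg_cong[OF main]) simp
    then show False using \<open>i \<in> S\<close> by (simp add: \<Theta>_e \<sigma>_def pconst_simps)
  qed
  then show "S = {}" by blast
  show "\<phi> (- \<epsilon> i) l = pvar l * pconst (inverse (\<Lambda> i))" if "l \<noteq> i"
  proof -
    have "\<phi> (- \<epsilon> i) l * pconst (\<Lambda> i) = pvar l" using main[OF that] notin[of i] by (simp add: \<Theta>_e)
    then have "\<phi> (- \<epsilon> i) l * (pconst (\<Lambda> i) * pconst (inverse (\<Lambda> i))) = pvar l * pconst (inverse (\<Lambda> i))"
      by (simp add: mult.assoc[symmetric])
    then show ?thesis by (simp add: pconst_simps(4)[symmetric] pconst_simps(2) \<Lambda>_nonzero)
  qed
qed

lemma settled_single:
  assumes "regular (Poly_Mapping.single i c)"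
  shows "settled (Poly_Mapping.single i c)"
proof (cases "c \<ge> 0")
  case True
  then show ?thesis using settled_multiple[OF settled_e[of i], of "nat c"] by simp
next
  case False
  then have full: full and S: "S = {}"
    using assms by (auto simp: regular_def lookup_single when_def split: if_splits)
  have "seq_power \<Lambda> (- \<epsilon> i) = inverse (\<Lambda> i)"
    by (simp add: seq_power_single power_int_minus flip: single_uminus)
  moreover have "phi_prod S a (- \<epsilon> i) = 1" by (simp add: S phi_prod_empty)
  ultimately have "\<Theta> (- \<epsilon> i) = pconst (inverse (\<Lambda> i))"
    by (simp add: \<Theta>_def)
  moreover have "regular (- \<epsilon> i)" unfolding regular_def by (intro disjI1 conjI full S)
  ultimately have "settled (- \<epsilon> i)"
    using full_imp_S_empty(2)[OF full]
    by (auto simp: settled_def lookup_single when_def split: if_splits)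
  then have "settled (Poly_Mapping.single i (- 1))" by (simp only: single_uminus)
  from settled_multiple[OF this, of "nat (- c)"] False show ?thesis by simp
qed

lemma regular_imp_settled:
  assumes "regular k"
  shows "settled k"
  by (rule settled_if_single_settled[OF _ assms]) (rule settled_single)

text \<open>Regular exponents are covered by \<open>settled_formula\<close>. The other exponents of \<open>W\<^sub>\<infinity>\<^sup>+\<close> have
  \<open>k\<^sub>j = -1\<close> and are covered by \<open>settled_lower\<close>.\<close>

lemma cocycle_eq:
  assumes "k \<in> index_set full j"
  shows "\<phi> k j = pconst (seq_power \<Lambda> k) * phi S a k j"
proof (cases "Poly_Mapping.lookup k j = -1 \<and> \<not> (full \<and> S = {})")
  case False
  then have "regular k"
  proof -
    have "full \<and> S = {} \<or> (\<forall>i. Poly_Mapping.lookup k i \<ge> 0)"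
    proof (cases full)
      case True
      then show ?thesis using full_imp_S_empty(1)[OF True] by simp
    next
      case nf: False
      have "Poly_Mapping.lookup k i \<ge> 0" for i
        using False nf assms by (cases "i = j") (auto simp: in_index_set)
      then show ?thesis by blast
    qed
    then show ?thesis by (simp add: regular_def)
  qed
  then have "settled k" by (rule regular_imp_settled)
  moreover have "\<not> (Poly_Mapping.lookup k j = -1 \<and> j \<in> S)"
    using \<open>regular k\<close> unfolding regular_def by (auto dest: spec[of _ j])
  ultimately show ?thesis
    using settled_formula[of k j] by (auto simp: phi_def \<Theta>_def)
next
  case True
  then have nf: "\<not> full" using full_imp_S_empty(1) by blast
  define k' where "k' = k + \<epsilon> j"
  have k: "k = k' - \<epsilon> j" and k'j: "Poly_Mapping.lookup k' j = 0"
    using True by (simp_all add: k'_def lookup_add)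
  have k'i: "i \<noteq> j \<Longrightarrow> Poly_Mapping.lookup k' i = Poly_Mapping.lookup k i" for i
    by (simp add: k'_def lookup_add lookup_single when_def)
  have "Poly_Mapping.lookup k' i \<ge> 0" for i
    using assms nf k'j k'i by (cases "i = j") (auto simp: in_index_set)
  then have "regular k'" by (simp add: regular_def)
  then have "settled k'" by (rule regular_imp_settled)
  then have \<phi>: "\<phi> k j = \<phi> (- \<epsilon> j) j * \<Theta> k'" unfolding k by (rule settled_lower) (rule k'j)
  have "seq_power \<Lambda> k' = seq_power \<Lambda> k * \<Lambda> j"
    unfolding k'_def by (simp add: seq_power_add \<Lambda>_nonzero seq_power_single)
  then have \<Theta>k': "\<Theta> k' = pconst (\<Lambda> j) * (pconst (seq_power \<Lambda> k) * phi_prod S a k')"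
    by (simp add: \<Theta>_def pconst_simps)
  have "S \<inter> Poly_Mapping.keys k' = (S - {j}) \<inter> Poly_Mapping.keys k"
    using k'j k'i by (auto simp: in_keys_iff) metis+
  then have prod: "phi_prod S a k' = phi_prod (S - {j}) a k"
    unfolding phi_prod_def by (rule prod.cong) (auto simp: k'i)
  show ?thesis
  proof (cases "j \<in> S")
    case jS: True
    then show ?thesis using True
      by (simp add: \<phi> \<Theta>k' prod lower_normal phi_def pconst_inverse_\<Lambda>)
  next
    case False
    then have "S - {j} = S" by blast
    then have "\<phi> k j = pconst (inverse (\<Lambda> j)) * (pconst (\<Lambda> j) *
        ((pvar j + pconst (a + 1)) * (pconst (seq_power \<Lambda> k) * phi_prod S a k)))"
      using False by (simp add: \<phi> \<Theta>k' prod lower_normal mult_ac)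
    also have "\<dots> = pconst (seq_power \<Lambda> k) * ((pvar j + pconst (a + 1)) * phi_prod S a k)"
      unfolding pconst_inverse_\<Lambda> by (rule mult.left_commute)
    finally show ?thesis using True False by (simp add: phi_def pconst_simps)
  qed
qed

end

section \<open>From modules to cocycles\<close>

lemma funpow_commute:
  assumes "\<And>w. f (g w) = g (f w)"
  shows "f ((g ^^ n) w) = (g ^^ n) (f w)"
  by (induction n) (simp_all add: assms)

lemma foldr_funpow_step:
  assumes comm: "\<And>i j w. d i (d j w) = d j (d i w)"
    and "j \<in> set xs" "distinct xs" "m' j = Suc (m j)" "\<And>i. i \<noteq> j \<Longrightarrow> m' i = m i"
  shows "d j (foldr (\<lambda>i. d i ^^ m i) xs v) = foldr (\<lambda>i. d i ^^ m' i) xs v"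
  using assms(2,3)
proof (induction xs)
  case (Cons x xs)
  show ?case
  proof (cases "j = x")
    case True
    have "foldr (\<lambda>i. d i ^^ m i) xs v = foldr (\<lambda>i. d i ^^ m' i) xs v"
    proof (rule foldr_cong[OF refl refl])
      fix i w assume "i \<in> set xs"
      then have "i \<noteq> j" using Cons.prems True by auto
      then have "m' i = m i" by (rule assms(5))
      then show "(d i ^^ m i) w = (d i ^^ m' i) w" by simp
    qed
    then show ?thesis by (simp add: True assms(4)[unfolded True])
  next
    case False
    then have IH: "d j (foldr (\<lambda>i. d i ^^ m i) xs v) = foldr (\<lambda>i. d i ^^ m' i) xs v"
      using Cons.prems by (intro Cons.IH) simp_all
    have "m' x = m x" using False by (intro assms(5)) simp
    moreover have "d j ((d x ^^ m x) w) = (d x ^^ m x) (d j w)" for w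
      by (rule funpow_commute) (rule comm)
    ultimately show ?thesis by (simp add: IH)
  qed
qed simp

text \<open>The list of all \<open>i\<close> with nonzero exponent varies with the monomial. Padding it with exponents 0
  allows monomials to be compared along one list.\<close>

lemma foldr_funpow_superset:
  fixes m :: "nat \<Rightarrow>\<^sub>0 nat"
  assumes "finite A" "Poly_Mapping.keys m \<subseteq> A"
  shows "foldr (\<lambda>i. d i ^^ Poly_Mapping.lookup m i) (sorted_list_of_set (Poly_Mapping.keys m)) v
       = foldr (\<lambda>i. d i ^^ Poly_Mapping.lookup m i) (sorted_list_of_set A) v"
proof -
  have *: "foldr (\<lambda>i. d i ^^ Poly_Mapping.lookup m i) xs v
      = foldr (\<lambda>i. d i ^^ Poly_Mapping.lookup m i) (filter (\<lambda>i. i \<in> Poly_Mapping.keys m) xs) v" for xs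
    by (induction xs) (auto simp: in_keys_iff)
  have "sorted_list_of_set (Poly_Mapping.keys m) = filter (\<lambda>i. i \<in> Poly_Mapping.keys m) (sorted_list_of_set A)"
    using assms by (intro sorted_distinct_set_unique) (auto simp: sorted_wrt_filter)
  then show ?thesis using *[of "sorted_list_of_set A"] by simp
qed

lemma cartan_monom_act_step:
  assumes "\<And>i j w. act (witt_basis 0 i) (act (witt_basis 0 j) w) = act (witt_basis 0 j) (act (witt_basis 0 i) w)"
  shows "cartan_monom_act act (Poly_Mapping.single j 1 + m) v = act (witt_basis 0 j) (cartan_monom_act act m v)"
proof -
  let ?A = "insert j (Poly_Mapping.keys m)"
  have sub: "Poly_Mapping.keys (Poly_Mapping.single j 1 + m) \<subseteq> ?A"
    using keys_add[of "Poly_Mapping.single j 1" m] by auto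
  have set: "j \<in> set (sorted_list_of_set ?A)"
    by (subst set_sorted_list_of_set) auto
  have sub': "Poly_Mapping.keys m \<subseteq> ?A" and fin: "finite ?A" by auto
  have "act (witt_basis 0 j) (foldr (\<lambda>i. act (witt_basis 0 i) ^^ Poly_Mapping.lookup m i) (sorted_list_of_set ?A) v)
    = foldr (\<lambda>i. act (witt_basis 0 i) ^^ Poly_Mapping.lookup (Poly_Mapping.single j 1 + m) i) (sorted_list_of_set ?A) v"
    by (rule foldr_funpow_step[where d = "\<lambda>i. act (witt_basis 0 i)", OF assms set distinct_sorted_list_of_set])
      (simp_all add: lookup_add lookup_single)
  then show ?thesis
    unfolding cartan_monom_act_def foldr_funpow_superset[OF fin sub] foldr_funpow_superset[OF fin sub']
    by (rule sym)
qed

lemma pscale_eq: "pscale c p = pconst c * p"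
  by (simp add: pscale_def)

lemma vector_space_pscale: "vector_space pscale"
  by unfold_locales (simp_all add: pscale_def pconst_simps algebra_simps)

definition witt_part :: "bool \<Rightarrow> witt set" where
  "witt_part full = (if full then UNIV else witt_plus)"

lemma lookup_witt_scale: "Poly_Mapping.lookup (witt_scale c x) q = c * Poly_Mapping.lookup x q"
  by (simp add: witt_scale_def Poly_Mapping.map.rep_eq when_def)

lemma witt_scale_0 [simp]: "witt_scale 0 x = 0" "witt_scale c 0 = 0"
  by (simp_all add: poly_mapping_eqI lookup_witt_scale)

lemma witt_scale_1 [simp]: "witt_scale 1 x = x"
  by (simp add: poly_mapping_eqI lookup_witt_scale)

lemma witt_expansion:
  "x = (\<Sum>(k, i)\<in>Poly_Mapping.keys x. witt_scale (Poly_Mapping.lookup x (k, i)) (witt_basis k i))"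
proof (rule poly_mapping_eqI)
  fix q
  have "Poly_Mapping.lookup (\<Sum>(k, i)\<in>Poly_Mapping.keys x. witt_scale (Poly_Mapping.lookup x (k, i)) (witt_basis k i)) q
      = (\<Sum>p\<in>Poly_Mapping.keys x. if p = q then Poly_Mapping.lookup x q else 0)"
    unfolding lookup_sum
    by (rule sum.cong) (auto simp: lookup_witt_scale witt_basis_def lookup_single when_def)
  then show "Poly_Mapping.lookup x q = Poly_Mapping.lookup
      (\<Sum>(k, i)\<in>Poly_Mapping.keys x. witt_scale (Poly_Mapping.lookup x (k, i)) (witt_basis k i)) q"
    by (simp add: in_keys_iff)
qed

lemma witt_part_iff: "x \<in> witt_part full \<longleftrightarrow> (\<forall>(k, i)\<in>Poly_Mapping.keys x. k \<in> index_set full i)"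
  by (auto simp: witt_part_def index_set_def witt_plus_def)

lemma witt_part_basis: "witt_basis k i \<in> witt_part full \<longleftrightarrow> k \<in> index_set full i"
  by (simp add: witt_part_iff witt_basis_def)

lemma witt_part_0: "0 \<in> witt_part full"
  by (simp add: witt_part_iff)

lemma witt_part_add: "x \<in> witt_part full \<Longrightarrow> y \<in> witt_part full \<Longrightarrow> x + y \<in> witt_part full"
  using keys_add[of x y] unfolding witt_part_iff by blast

lemma witt_part_scale: "x \<in> witt_part full \<Longrightarrow> witt_scale c x \<in> witt_part full"
  unfolding witt_part_iff by (auto simp: in_keys_iff lookup_witt_scale)

lemma witt_bracket_basis:
  "witt_bracket (witt_basis r i) (witt_basis s j) =
     witt_scale (of_int (Poly_Mapping.lookup s i)) (witt_basis (r + s) j)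
     + witt_scale (- 1) (witt_scale (of_int (Poly_Mapping.lookup r j)) (witt_basis (r + s) i))"
proof -
  have "- x = witt_scale (- 1) x" for x
    by (simp add: poly_mapping_eqI lookup_witt_scale)
  then show ?thesis by (simp add: witt_bracket_def witt_basis_def flip: diff_conv_add_uminus)
qed

text \<open>The choice of a free generator \<open>v\<close> gives the identification \<open>\<Psi>\<close> of the polynomial ring with
  the module, and its inverse \<open>T\<close>.\<close>

locale cartan_free_module = witt_module "witt_part full" scale act
  for full :: bool and scale :: "complex \<Rightarrow> 'v \<Rightarrow> 'v::ab_group_add" and act :: "witt \<Rightarrow> 'v \<Rightarrow> 'v" +
  fixes v :: 'v
  assumes free: "\<And>u. \<exists>!p. cartan_act scale act p v = u"
begin

definition \<Psi> :: "cpoly \<Rightarrow> 'v" where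
  "\<Psi> p = cartan_act scale act p v"

lemma bij_\<Psi>: "bij \<Psi>"
  unfolding bij_iff \<Psi>_def by (intro allI free)

lemma act_add_vec: "x \<in> witt_part full \<Longrightarrow> act x (u + w) = act x u + act x w"
  and act_scale_vec: "x \<in> witt_part full \<Longrightarrow> act x (scale c u) = scale c (act x u)"
proof -
  assume x: "x \<in> witt_part full"
  interpret l: Vector_Spaces.linear scale scale "act x" using x by (rule act_linear)
  show "act x (u + w) = act x u + act x w" by (rule l.add)
  show "act x (scale c u) = scale c (act x u)" by (rule l.scale)
qed

lemma act_0: "act 0 u = 0"
  using act_scale[OF witt_part_0, of 0 u] by simp

lemma act_scaled_basis:
  assumes "c \<noteq> 0 \<Longrightarrow> k \<in> index_set full i"
  shows "witt_scale c (witt_basis k i) \<in> witt_part full"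
    "act (witt_scale c (witt_basis k i)) u = scale c (act (witt_basis k i) u)"
  using assms by (cases "c = 0"; simp add: act_0 witt_part_0 witt_part_basis witt_part_scale act_scale)+

lemma act_basis_bracket:
  assumes "r \<in> index_set full i" "s \<in> index_set full j"
    "Poly_Mapping.lookup s i \<noteq> 0 \<Longrightarrow> r + s \<in> index_set full j"
    "Poly_Mapping.lookup r j \<noteq> 0 \<Longrightarrow> r + s \<in> index_set full i"
  shows "act (witt_basis r i) (act (witt_basis s j) u) - act (witt_basis s j) (act (witt_basis r i) u) =
      scale (of_int (Poly_Mapping.lookup s i)) (act (witt_basis (r + s) j) u)
      - scale (of_int (Poly_Mapping.lookup r j)) (act (witt_basis (r + s) i) u)"
proof -
  let ?A = "witt_scale (of_int (Poly_Mapping.lookup s i)) (witt_basis (r + s) j)"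
  let ?B = "witt_scale (of_int (Poly_Mapping.lookup r j)) (witt_basis (r + s) i)"
  have A: "?A \<in> witt_part full" and B: "?B \<in> witt_part full"
    using assms(3,4) by (auto intro!: act_scaled_basis(1))
  have "act (?A + witt_scale (- 1) ?B) u = act ?A u - act ?B u"
    using A B by (simp add: act_add witt_part_scale act_scale)
  also have "\<dots> = scale (of_int (Poly_Mapping.lookup s i)) (act (witt_basis (r + s) j) u)
      - scale (of_int (Poly_Mapping.lookup r j)) (act (witt_basis (r + s) i) u)"
    using assms(3,4) by (intro arg_cong2[where f = "(-)"] act_scaled_basis(2)) simp_all
  finally show ?thesis
    using act_bracket[of "witt_basis r i" "witt_basis s j" u] assms(1,2)
    by (simp add: witt_part_basis witt_bracket_basis)
qed

lemma cartan_commute: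
  "act (witt_basis 0 i) (act (witt_basis 0 j) w) = act (witt_basis 0 j) (act (witt_basis 0 i) w)"
  using act_basis_bracket[OF units_in_index_set(1) units_in_index_set(1), of i j w] by simp

lemma \<Psi>_superset:
  "finite A \<Longrightarrow> Poly_Mapping.keys p \<subseteq> A \<Longrightarrow>
    \<Psi> p = (\<Sum>m\<in>A. scale (Poly_Mapping.lookup p m) (cartan_monom_act act m v))"
  unfolding \<Psi>_def cartan_act_def by (rule sum.mono_neutral_left) (auto simp: in_keys_iff)

lemma \<Psi>_add: "\<Psi> (p + q) = \<Psi> p + \<Psi> q"
  by (simp add: \<Psi>_superset[of "Poly_Mapping.keys p \<union> Poly_Mapping.keys q"] keys_add
      lookup_add scale_left_distrib sum.distrib)

lemma \<Psi>_0: "\<Psi> 0 = 0"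
  by (simp add: \<Psi>_def cartan_act_def)

lemma \<Psi>_single: "\<Psi> (Poly_Mapping.single m c) = scale c (cartan_monom_act act m v)"
  by (simp add: \<Psi>_def cartan_act_def)

lemma \<Psi>_scale: "\<Psi> (pscale c p) = scale c (\<Psi> p)"
  by (induction p rule: poly_mapping_induct_add)
    (simp_all add: \<Psi>_0 \<Psi>_add \<Psi>_single pscale_def pconst_def mult_single distrib_left scale_right_distrib)

lemma \<Psi>_pvar_mult: "\<Psi> (pvar i * p) = act (witt_basis 0 i) (\<Psi> p)"
proof -
  have b: "witt_basis 0 i \<in> witt_part full" by (simp add: witt_part_basis units_in_index_set(1))
  have z: "act (witt_basis 0 i) 0 = 0" using act_scale_vec[OF b, of 0 0] by simp
  show ?thesis
    by (induction p rule: poly_mapping_induct_add)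
      (simp_all add: \<Psi>_0 \<Psi>_add \<Psi>_single z pvar_def mult_single distrib_left b act_add_vec
        act_scale_vec cartan_monom_act_step[where act = act, OF cartan_commute] del: One_nat_def)
qed

definition T :: "'v \<Rightarrow> cpoly" where
  "T = inv \<Psi>"

lemma T_\<Psi> [simp]: "T (\<Psi> p) = p"
  unfolding T_def by (simp add: bij_\<Psi> bij_is_inj)

lemma \<Psi>_T [simp]: "\<Psi> (T u) = u"
  unfolding T_def by (simp add: bij_\<Psi> bij_is_surj surj_f_inv_f)

lemma bij_T: "bij T"
  unfolding T_def by (rule bij_imp_bij_inv[OF bij_\<Psi>])

lemma T_add: "T (u + w) = T u + T w"
  by (metis T_\<Psi> \<Psi>_T \<Psi>_add)

lemma T_scale: "T (scale c u) = pconst c * T u"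
  by (metis T_\<Psi> \<Psi>_T \<Psi>_scale pscale_eq)

lemma T_0: "T 0 = 0"
  by (metis T_\<Psi> \<Psi>_0)

lemma T_diff: "T (u - w) = T u - T w"
  using T_add[of "u - w" w] by (simp add: algebra_simps)

lemma T_cartan: "T (act (witt_basis 0 i) u) = pvar i * T u"
  by (metis T_\<Psi> \<Psi>_T \<Psi>_pvar_mult)

lemma linear_T: "Vector_Spaces.linear scale pscale T"
  using vector_space_axioms vector_space_pscale
  unfolding Vector_Spaces.linear_def module_hom_def module_hom_axioms_def module_iff_vector_space
  by (simp add: T_add T_scale pscale_eq)

definition \<phi> :: "int_seq \<Rightarrow> nat \<Rightarrow> cpoly" where
  "\<phi> k i = T (act (witt_basis k i) (\<Psi> 1))"

text \<open>The induction is over the first factor, with the second one arbitrary, so that products of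
  polynomials pose no problem. For a variable this is \<open>[\<partial>\<^sub>j, t\<^sup>k \<partial>\<^sub>i] = k\<^sub>j t\<^sup>k \<partial>\<^sub>i\<close>.\<close>

lemma T_act_basis_mult:
  assumes k: "k \<in> index_set full i"
  shows "T (act (witt_basis k i) (\<Psi> (f * g))) = pshift k f * T (act (witt_basis k i) (\<Psi> g))"
proof (induction f arbitrary: g rule: cpoly_induct)
  case (const c)
  have "\<Psi> (pconst c * g) = scale c (\<Psi> g)" using \<Psi>_scale[of c g] by (simp add: pscale_eq)
  then show ?case using k by (simp add: act_scale_vec witt_part_basis T_scale)
next
  case (var j)
  have "T (act (witt_basis 0 j) (act (witt_basis k i) (\<Psi> g)) - act (witt_basis k i) (act (witt_basis 0 j) (\<Psi> g)))
      = T (scale (of_int (Poly_Mapping.lookup k j)) (act (witt_basis k i) (\<Psi> g)))"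
    using act_basis_bracket[OF units_in_index_set(1) k, of j "\<Psi> g"] k by simp
  then have "T (act (witt_basis k i) (act (witt_basis 0 j) (\<Psi> g)))
      = (pvar j - of_int (Poly_Mapping.lookup k j)) * T (act (witt_basis k i) (\<Psi> g))"
    by (simp add: T_diff T_cartan T_scale pconst_simps algebra_simps)
  then show ?case by (simp add: \<Psi>_pvar_mult)
next
  case (add p q)
  then show ?case
    using k by (simp add: distrib_right \<Psi>_add act_add_vec witt_part_basis T_add)
next
  case (mult p q)
  then show ?case by (simp add: mult.assoc)
qed

lemma T_act_basis:
  assumes "k \<in> index_set full i"
  shows "T (act (witt_basis k i) u) = pshift k (T u) * \<phi> k i"
  using T_act_basis_mult[OF assms, of "T u" 1] by (simp add: \<phi>_def)

sublocale witt_cocycle full \<phi>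
proof
  show "\<phi> 0 j = pvar j" for j
    by (simp add: \<phi>_def T_cartan)
  fix r s :: int_seq and i j :: nat
  assume a: "r \<in> index_set full i" "s \<in> index_set full j"
      "Poly_Mapping.lookup s i \<noteq> 0 \<Longrightarrow> r + s \<in> index_set full j"
      "Poly_Mapping.lookup r j \<noteq> 0 \<Longrightarrow> r + s \<in> index_set full i"
  from arg_cong[OF act_basis_bracket[OF a, of "\<Psi> 1"], of T]
  have "pshift r (\<phi> s j) * \<phi> r i - pshift s (\<phi> r i) * \<phi> s j =
      pconst (of_int (Poly_Mapping.lookup s i)) * \<phi> (r + s) j - pconst (of_int (Poly_Mapping.lookup r j)) * \<phi> (r + s) i"
    using a(1,2) by (simp add: T_diff T_scale T_act_basis[of _ _ "act _ _"] flip: \<phi>_def)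
  then show "\<phi> r i * pshift r (\<phi> s j) - \<phi> s j * pshift s (\<phi> r i) =
      of_int (Poly_Mapping.lookup s i) * \<phi> (r + s) j - of_int (Poly_Mapping.lookup r j) * \<phi> (r + s) i"
    by (simp add: pconst_simps mult.commute)
qed

lemma T_act:
  assumes "x \<in> witt_part full"
  shows "T (act x u) = linear_extension (\<lambda>k i f. pshift k f * \<phi> k i) x (T u)"
proof -
  have "(\<Sum>(k, i)\<in>A. witt_scale (c k i) (witt_basis k i)) \<in> witt_part full \<and>
      T (act (\<Sum>(k, i)\<in>A. witt_scale (c k i) (witt_basis k i)) u)
        = (\<Sum>(k, i)\<in>A. pscale (c k i) (pshift k (T u) * \<phi> k i))"
    if "finite A" "\<forall>(k, i)\<in>A. k \<in> index_set full i" for A c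
    using that
  proof (induction A rule: finite_induct)
    case empty
    show ?case by (simp add: witt_part_0 act_0 T_0)
  next
    case (insert q A)
    obtain k i where q: "q = (k, i)" by (cases q)
    have k: "k \<in> index_set full i" using insert by (simp add: q)
    show ?case
      using insert act_scaled_basis[OF k, of "c k i"]
      by (simp add: q witt_part_add act_add T_add T_scale T_act_basis[OF k] pscale_eq)
  qed
  from this[OF finite_keys[of x], of "\<lambda>k i. Poly_Mapping.lookup x (k, i)"] assms
  show ?thesis
    unfolding witt_part_iff linear_extension_def using witt_expansion[of x] by simp
qed

lemma classification:
  obtains \<Lambda> :: "nat \<Rightarrow> complex" and a S where "\<And>i. \<Lambda> i \<noteq> 0" "full \<Longrightarrow> S = {}"
    "\<And>x u. x \<in> witt_part full \<Longrightarrow> T (act x u) = Omega_plus_act \<Lambda> a S x (T u)"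
proof -
  obtain \<Lambda> :: "nat \<Rightarrow> complex" and a S where "\<And>i. \<Lambda> i \<noteq> 0"
    "\<And>i. \<phi> (- \<epsilon> i) i = pconst (inverse (\<Lambda> i)) * (if i \<in> S then 1 else pvar i + pconst (a + 1))"
    "\<And>i j. j \<noteq> i \<Longrightarrow> \<phi> (\<epsilon> i) j = pvar j * (pconst (\<Lambda> i) * (if i \<in> S then pvar i + pconst a else 1))"
    by (rule lower_raise_normal_form) (rule that; assumption)
  then interpret normalised_cocycle full \<phi> \<Lambda> a S by unfold_locales
  have "T (act x u) = Omega_plus_act \<Lambda> a S x (T u)" if x: "x \<in> witt_part full" for x u
    unfolding T_act[OF x] Omega_plus_act_def linear_extension_def
    by (rule sum.cong) (use x in \<open>auto simp: witt_part_iff cocycle_eq pscale_eq ac_simps\<close>)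
  with \<Lambda>_nonzero full_imp_S_empty(1) show ?thesis by (rule that)
qed

end

section \<open>The classification\<close>

lemma Omega_plus_act_empty: "Omega_plus_act \<Lambda> a {} = Omega_act \<Lambda> a"
  unfolding Omega_plus_act_def Omega_act_def
  by (simp add: phi_def phi_prod_empty mult.commute)

lemma free_rank_one_module_iso:
  fixes scale :: "complex \<Rightarrow> 'v \<Rightarrow> 'v::ab_group_add"
  assumes "witt_module (witt_part full) scale act" "cartan_free_rank_one scale act"
  obtains \<Lambda> :: "nat \<Rightarrow> complex" and a S where "\<And>i. \<Lambda> i \<noteq> 0" "full \<Longrightarrow> S = {}"
    "witt_module_iso (witt_part full) scale act pscale (Omega_plus_act \<Lambda> a S)"
proof -
  obtain v where "\<And>u. \<exists>!p. cartan_act scale act p v = u"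
    using assms(2) unfolding cartan_free_rank_one_def by blast
  then interpret cartan_free_module full scale act v
    using assms(1) by (simp add: cartan_free_module_def cartan_free_module_axioms_def)
  show ?thesis
  proof (rule classification)
    fix \<Lambda> :: "nat \<Rightarrow> complex" and a S
    assume *: "\<And>i. \<Lambda> i \<noteq> 0" "full \<Longrightarrow> S = {}"
      "\<And>x u. x \<in> witt_part full \<Longrightarrow> T (act x u) = Omega_plus_act \<Lambda> a S x (T u)"
    have "witt_module_iso (witt_part full) scale act pscale (Omega_plus_act \<Lambda> a S)"
      unfolding witt_module_iso_def using linear_T bij_T *(3) by blast
    with *(1,2) show thesis by (rule that)
  qed
qed

theorem theorem10:
  fixes scaleV :: "complex \<Rightarrow> 'v \<Rightarrow> 'v::ab_group_add"
    and actV :: "witt \<Rightarrow> 'v \<Rightarrow> 'v"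
    and scaleM :: "complex \<Rightarrow> 'm \<Rightarrow> 'm::ab_group_add"
    and actM :: "witt \<Rightarrow> 'm \<Rightarrow> 'm"
  shows "(witt_module witt_plus scaleV actV \<and> cartan_free_rank_one scaleV actV \<longrightarrow>
           (\<exists>(\<Lambda> :: nat \<Rightarrow> complex) (a :: complex) (S :: nat set).
              (\<forall>i. \<Lambda> i \<noteq> 0) \<and>
              witt_module_iso witt_plus scaleV actV pscale (Omega_plus_act \<Lambda> a S)))
       \<and> (witt_module UNIV scaleM actM \<and> cartan_free_rank_one scaleM actM \<longrightarrow>
           (\<exists>(\<Lambda> :: nat \<Rightarrow> complex) (a :: complex).
              (\<forall>i. \<Lambda> i \<noteq> 0) \<and>
              witt_module_iso UNIV scaleM actM pscale (Omega_act \<Lambda> a)))"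
proof (intro conjI impI; elim conjE)
  assume V: "witt_module witt_plus scaleV actV" "cartan_free_rank_one scaleV actV"
  have plus: "witt_part False = witt_plus" by (simp add: witt_part_def)
  show "\<exists>(\<Lambda> :: nat \<Rightarrow> complex) (a :: complex) (S :: nat set).
      (\<forall>i. \<Lambda> i \<noteq> 0) \<and> witt_module_iso witt_plus scaleV actV pscale (Omega_plus_act \<Lambda> a S)"
    by (rule free_rank_one_module_iso[of False scaleV actV, unfolded plus, OF V]) blast
next
  assume M: "witt_module UNIV scaleM actM" "cartan_free_rank_one scaleM actM"
  have univ: "witt_part True = UNIV" by (simp add: witt_part_def)
  show "\<exists>(\<Lambda> :: nat \<Rightarrow> complex) (a :: complex).
      (\<forall>i. \<Lambda> i \<noteq> 0) \<and> witt_module_iso UNIV scaleM actM pscale (Omega_act \<Lambda> a)"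
  proof (rule free_rank_one_module_iso[of True scaleM actM, unfolded univ, OF M])
    fix \<Lambda> :: "nat \<Rightarrow> complex" and a S
    assume "\<And>i. \<Lambda> i \<noteq> 0" "True \<Longrightarrow> S = {}"
      "witt_module_iso UNIV scaleM actM pscale (Omega_plus_act \<Lambda> a S)"
    then have "\<forall>i. \<Lambda> i \<noteq> 0" "witt_module_iso UNIV scaleM actM pscale (Omega_act \<Lambda> a)"
      by (simp_all add: Omega_plus_act_empty)
    then show ?thesis by blast
  qed
qed

end
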